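(* Let $SL(2,\mathbb{R})$ act continuously (on the left) on a locally compact space $X$, let $x\in X$, and let $I\subset\mathbb{T}=\mathbb{R}/2\pi\mathbb{Z}$ be a compact subinterval, of length $|I|$. If the weak* limit $$\mu:=\lim_{T\to+\infty}\frac1T\int_0^T\frac1{|I|}\int_I (g_t\circ r_\theta)_*(\delta_x)\,d\theta\,dt$$ exists and is $g_{\mathbb{R}}$-ergodic, then for Lebesgue almost all $\theta\in I$ there exists a set $Z_\theta\subset\mathbb{R}$ of zero lower density such that we have the weak* limit $$\mu=\lim_{T\to+\infty,\ T\notin Z_\theta}\frac1T\int_0^T(g_t\circ r_\theta)_*(\delta_x)\,dt .$$
   Context: Notation: $g_t=\begin{pmatrix}e^t&0\\0&e^{-t}\end{pmatrix}$, $r_\theta=\begin{pmatrix}\cos\theta&\sin\theta\\-\sin\theta&\cos\theta\end{pmatrix}$, acting on $X$ through the given $SL(2,\mathbb{R})$-action. $\delta_x$ is the Dirac mass at $x$; $(\cdot)_*$ is push-forward. Weak* convergence of Borel measures on $X$ means convergence of integrals of every continuous compactly supported function. A set $Z\subset\mathbb{R}$ has zero lower density if $\liminf_{T\to+\infty}\frac1T\mathrm{Leb}(Z\cap[0,T])=0$. "$g_{\mathbb{R}}$-ergodic" means ergodic under the flow $(g_t)_{t\in\mathbb{R}}$.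
   Formalization: X is taken Hausdorff and second countable; without countability the claim fails, e.g. on an uncountable power of the compact space of 1-Lipschitz functions from the hyperbolic plane to [0,1]. "Ergodic" means ergodic invariant probability measure. *)

theory Defs
  imports "HOL-Probability.Probability"
begin

text \<open>
  Standing convention: locally compact spaces are Hausdorff and second countable. Some
  countability is indispensable: on an uncountable product of compact \<open>SL(2,\<real>)\<close>-spaces, every
  direction \<open>\<theta>\<close> may have its own test function that witnesses non-convergence, although
  each test function sees only a null set of exceptional directions.

  A nondegenerate compact interval of the circle \<open>\<real> / 2\<pi>\<int>\<close> is represented by a lift
  \<open>[a, b]\<close> with \<open>a < b \<le> a + 2\<pi>\<close>; its length is \<open>b - a\<close>.
\<close>

definition SL2 :: "(real^2^2) set"
  where "SL2 = {A. det A = 1}"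

definition continuous_SL2_action :: "(real^2^2 \<Rightarrow> 'a::topological_space \<Rightarrow> 'a) \<Rightarrow> bool"
  where "continuous_SL2_action act \<longleftrightarrow>
    continuous_on (SL2 \<times> UNIV) (\<lambda>(A, y). act A y) \<and>
    (\<forall>y. act (mat 1) y = y) \<and>
    (\<forall>A\<in>SL2. \<forall>B\<in>SL2. \<forall>y. act (A ** B) y = act A (act B y))"

definition geo :: "real \<Rightarrow> real^2^2"
  where "geo t = vector [vector [exp t, 0], vector [0, exp (- t)]]"

definition rot :: "real \<Rightarrow> real^2^2"
  where "rot \<theta> = vector [vector [cos \<theta>, sin \<theta>], vector [- sin \<theta>, cos \<theta>]]"

definition pushed_dirac :: "(real^2^2 \<Rightarrow> 'a \<Rightarrow> 'a) \<Rightarrow> 'a::topological_space \<Rightarrow> real \<Rightarrow> real \<Rightarrow> 'a measure"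
  where "pushed_dirac act x t \<theta> = distr (return borel x) borel (act (geo t) \<circ> act (rot \<theta>))"

text \<open>
  Averages of families of measures are formed with the Giry monad: \<open>bind P N\<close> is the measure
  \<open>\<integral> N s dP(s)\<close>, and \<open>uniform_measure lborel {c..d}\<close> is \<open>ds / (d - c)\<close> on \<open>[c, d]\<close>.
\<close>

definition average :: "(real \<Rightarrow> 'a measure) \<Rightarrow> real \<Rightarrow> real \<Rightarrow> 'a measure"
  where "average N c d = bind (uniform_measure lborel {c..d}) N"

definition weak_star_limit ::
    "('i \<Rightarrow> 'a::topological_space measure) \<Rightarrow> 'a measure \<Rightarrow> 'i filter \<Rightarrow> bool"
  where "weak_star_limit N \<mu> F \<longleftrightarrow>
    (\<forall>f :: 'a \<Rightarrow> real. continuous_on UNIV f \<and> compact (closure {y. f y \<noteq> 0}) \<longrightarrow>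
      ((\<lambda>i. \<integral>y. f y \<partial>N i) \<longlongrightarrow> (\<integral>y. f y \<partial>\<mu>)) F)"

text \<open>
  As usual, an ergodic measure is an invariant probability measure. This is a genuine
  condition on a weak* limit of probability measures, which may in general lose mass.
\<close>

definition flow_ergodic :: "(real \<Rightarrow> 'a \<Rightarrow> 'a) \<Rightarrow> 'a::topological_space measure \<Rightarrow> bool"
  where "flow_ergodic \<phi> \<mu> \<longleftrightarrow>
    sets \<mu> = sets borel \<and> prob_space \<mu> \<and>
    (\<forall>t. distr \<mu> borel (\<phi> t) = \<mu>) \<and>
    (\<forall>A\<in>sets borel. (\<forall>t. \<phi> t -` A = A) \<longrightarrow> measure \<mu> A = 0 \<or> measure \<mu> A = 1)"

definition zero_lower_density :: "real set \<Rightarrow> bool"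
  where "zero_lower_density Z \<longleftrightarrow>
    Z \<in> sets lebesgue \<and>
    Liminf at_top (\<lambda>T. ereal (measure lebesgue (Z \<inter> {0..T}) / T)) = 0"

end

theory Submission
  imports Defs
begin

text \<open>
  Only the flow \<open>\<phi>\<^sub>t\<close> given by \<open>g\<^sub>t\<close> and the curve \<open>p \<theta> = r\<^sub>\<theta> x\<close> matter. Let \<open>f\<close> be a test
  function with mean \<open>m = \<mu>(f)\<close>. By the mean ergodic theorem some \<open>h\<close>, built from \<open>f\<close> by averaging
  translates along the flow, is \<open>L\<^sup>2(\<mu>)\<close>-close to \<open>m\<close>, and the time averages of \<open>f\<close> and \<open>h\<close> over
  \<open>[0, T]\<close> differ by \<open>O(1 / T)\<close>. By convexity the mean square over \<open>\<theta>\<close> of (time average of \<open>h\<close>) \<open>- m\<close>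
  is at most the integral of \<open>(h - m)\<^sup>2\<close> against the doubly averaged measure, which tends to the small
  number \<open>\<mu>((h - m)\<^sup>2)\<close>. So the time averages of \<open>f\<close> converge to \<open>m\<close> in mean over \<open>\<theta>\<close>; for
  countably many test functions this becomes convergence off a set of times of zero lower density
  for almost every \<open>\<theta>\<close>, and by Stone--Weierstrass countably many suffice.
\<close>

section \<open>A countable family of test functions\<close>

text \<open>Convergence in mean over \<open>\<theta>\<close> carries no rate. It makes the bad times
  rare only as a fraction of \<open>[0, S]\<close>, and only for \<open>S\<close> along a sparse
  sequence chosen afterwards; between the chosen times nothing is controlled. Hence lower density,
  and one set of times built for all test functions together. Two obstacles shape the analysis. The
  function \<open>h\<close> is integrated against the doubly averaged measures, which need not
  respect null sets of \<open>\<mu>\<close>, so an abstract limit in \<open>L\<^sup>2(\<mu>)\<close>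
  is useless and \<open>h\<close> must be continuous. Riesz's argument fits because its minimising
  sequence stays inside a set of continuous functions. Moreover \<open>(h - m)\<^sup>2\<close> need
  not have compact support, so weak* convergence does not apply to it directly; that
  \<open>\<mu>\<close> has mass one rescues the upper bound. Finally, integrals are not
  multiplicative: convergence for generators says nothing about their products. The countable family
  therefore consists of all products of generators.\<close>

definition test_function :: "('a::topological_space \<Rightarrow> real) \<Rightarrow> bool"
  where "test_function f \<longleftrightarrow> continuous_on UNIV f \<and> compact (closure {y. f y \<noteq> 0})"

lemma test_functionI:
  fixes f :: "'a::t2_space \<Rightarrow> real"
  assumes "continuous_on UNIV f" "compact K" "\<And>y. f y \<noteq> 0 \<Longrightarrow> y \<in> K"
  shows "test_function f"
proof -
  have "closure {y. f y \<noteq> 0} \<subseteq> K"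
    using assms compact_imp_closed by (intro closure_minimal) auto
  then have "closure {y. f y \<noteq> 0} = K \<inter> closure {y. f y \<noteq> 0}"
    by auto
  then have "compact (closure {y. f y \<noteq> 0})"
    using \<open>compact K\<close> closed_closure compact_Int_closed by metis
  then show ?thesis
    using assms by (simp add: test_function_def)
qed

lemma in_support: "f y \<noteq> 0 \<Longrightarrow> y \<in> closure {y. f y \<noteq> 0}"
  by (rule closure_subset[THEN subsetD]) simp

lemma test_function_continuous: "test_function f \<Longrightarrow> continuous_on UNIV f"
  by (simp add: test_function_def)

lemma test_function_mult:
  fixes f g :: "'a::t2_space \<Rightarrow> real"
  assumes "test_function f" "continuous_on UNIV g"
  shows "test_function (\<lambda>y. f y * g y)"
  using assms
  by (intro test_functionI[where K = "closure {y. f y \<noteq> 0}"])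
     (auto simp: test_function_def intro!: continuous_intros in_support)

lemma test_function_add:
  fixes f g :: "'a::t2_space \<Rightarrow> real"
  assumes "test_function f" "test_function g"
  shows "test_function (\<lambda>y. f y + g y)"
proof (rule test_functionI)
  show "compact (closure {y. f y \<noteq> 0} \<union> closure {y. g y \<noteq> 0})"
    using assms by (auto simp: test_function_def)
  show "y \<in> closure {y. f y \<noteq> 0} \<union> closure {y. g y \<noteq> 0}" if "f y + g y \<noteq> 0" for y
  proof -
    have "f y \<noteq> 0 \<or> g y \<noteq> 0" using that by auto
    then show ?thesis using in_support[of f y] in_support[of g y] by blast
  qed
qed (use assms in \<open>auto simp: test_function_def intro!: continuous_intros\<close>)

lemma test_function_sum:
  fixes f :: "'i \<Rightarrow> 'a::t2_space \<Rightarrow> real"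
  assumes "finite A" "\<And>i. i \<in> A \<Longrightarrow> test_function (f i)"
  shows "test_function (\<lambda>y. \<Sum>i\<in>A. f i y)"
  using assms
proof (induction A rule: finite_induct)
  case empty
  then show ?case by (intro test_functionI[where K = "{}"]) auto
next
  case (insert i A)
  then show ?case using test_function_add[of "f i"] by simp
qed

lemma test_function_bounded:
  assumes "test_function f"
  obtains C where "0 < C" "\<And>y. \<bar>f y\<bar> \<le> C"
proof -
  have "compact (f ` closure {y. f y \<noteq> 0})"
    using assms by (auto simp: test_function_def intro: compact_continuous_image continuous_on_subset)
  then obtain C where C: "0 < C" "\<And>z. z \<in> f ` closure {y. f y \<noteq> 0} \<Longrightarrow> \<bar>z\<bar> \<le> C"
    using compact_imp_bounded bounded_pos by (metis real_norm_def)
  have "\<bar>f y\<bar> \<le> C" for y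
    using C in_support[of f y] by (cases "f y = 0") auto
  with C show ?thesis using that by blast
qed

lemma test_function_separates:
  fixes x y :: "'a::t2_space"
  assumes lc: "locally_compact_space (euclidean :: 'a topology)" and "x \<noteq> y"
  obtains e where "test_function e" "e x \<noteq> 0" "e y = 0"
proof -
  have H: "Hausdorff_space (euclidean :: 'a topology)"
    unfolding Hausdorff_space_def using hausdorff by (metis disjnt_def open_openin topspace_euclidean)
  obtain U K where UK: "open U" "compact K" "x \<in> U" "U \<subseteq> K"
    using lc unfolding locally_compact_space_def by (metis UNIV_I compactin_euclidean_iff open_openin topspace_euclidean)
  have "completely_regular_space (euclidean :: 'a topology)"
    using lc H locally_compact_regular_imp_completely_regular_space by blast
  \<comment> \<open>Removing \<open>y\<close> from \<open>U\<close> lets one closed set serve two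
    purposes: \<open>1 - f\<close> vanishes at \<open>y\<close> and outside the compact set
    \<open>K\<close>.\<close>
  moreover have "closed (- (U - {y}))"
    using UK by (simp add: closed_Compl open_Diff)
  ultimately obtain f :: "'a \<Rightarrow> real"
    where f: "continuous_on UNIV f" "f x = 0" "f ` (- (U - {y})) \<subseteq> {1}"
    using UK \<open>x \<noteq> y\<close> unfolding completely_regular_space_def
    by (force simp: continuous_map_in_subtopology)
  show ?thesis
  proof (rule that[of "\<lambda>z. 1 - f z"])
    show "test_function (\<lambda>z. 1 - f z)"
      using f UK by (intro test_functionI[where K = K]) (auto intro!: continuous_intros)
  qed (use f in auto)
qed

lemma test_function_nonzero:
  fixes x :: "'a::t2_space"
  assumes lc: "locally_compact_space (euclidean :: 'a topology)"
  obtains e where "test_function e" "e x \<noteq> 0"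
proof (cases "\<exists>y. y \<noteq> x")
  case True
  then show ?thesis using test_function_separates[OF lc] that by metis
next
  \<comment> \<open>A one-point space offers no second point to separate from, but it is compact, so
    constants are test functions.\<close>
  case False
  then have "UNIV = {x}" by auto
  then have "compact (UNIV :: 'a set)" by (metis finite.emptyI finite.insertI finite_imp_compact)
  then have "test_function (\<lambda>z::'a. 1)"
    by (intro test_functionI[where K = UNIV]) auto
  then show ?thesis using that by fastforce
qed

text \<open>Lindelof twice: the open sets \<open>N e\<close> cover the space and the open sets
  \<open>W e\<close> cover the complement of the diagonal. The first countable subcover supplies
  cut-offs, the second the point separation for Stone--Weierstrass.\<close>

lemma countable_test_functions:
  assumes lc: "locally_compact_space (euclidean :: 'a topology)"
  obtains e :: "nat \<Rightarrow> 'a::{second_countable_topology, t2_space} \<Rightarrow> real"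
  where "\<And>n. test_function (e n)" "\<And>x. \<exists>n. e n x \<noteq> 0" "\<And>x y. x \<noteq> y \<Longrightarrow> \<exists>n. e n x \<noteq> e n y"
proof -
  define N where "N e = {x :: 'a. e x \<noteq> (0::real)}" for e
  define W where "W e = {p :: 'a \<times> 'a. e (fst p) \<noteq> (e (snd p) :: real)}" for e
  have oN: "open S" if S: "S \<in> N ` Collect test_function" for S
  proof -
    obtain e where e: "test_function e" "S = N e" using S by blast
    show ?thesis
      unfolding e(2) N_def using test_function_continuous[OF e(1)] by (intro open_Collect_neq) auto
  qed
  have oW: "open S" if S: "S \<in> W ` Collect test_function" for S
  proof -
    obtain e where e: "test_function e" "S = W e" using S by blast
    have "continuous_on UNIV (\<lambda>p :: 'a \<times> 'a. e (fst p))" "continuous_on UNIV (\<lambda>p :: 'a \<times> 'a. e (snd p))"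
      by (rule continuous_on_compose2[OF test_function_continuous[OF e(1)]];
          auto intro: continuous_on_fst continuous_on_snd continuous_on_id)+
    then show ?thesis unfolding e(2) W_def by (rule open_Collect_neq)
  qed
  obtain F where F: "F \<subseteq> N ` Collect test_function" "countable F" "\<Union>F = \<Union>(N ` Collect test_function)"
    using Lindelof[of "N ` Collect test_function"] oN by metis
  obtain G where G: "G \<subseteq> W ` Collect test_function" "countable G" "\<Union>G = \<Union>(W ` Collect test_function)"
    using Lindelof[of "W ` Collect test_function"] oW by metis
  obtain E1 where E1: "countable E1" "E1 \<subseteq> Collect test_function" "F = N ` E1"
    using F countable_subset_image by metis
  obtain E2 where E2: "countable E2" "E2 \<subseteq> Collect test_function" "G = W ` E2"
    using G countable_subset_image by metis
  \<comment> \<open>\<open>e0\<close> keeps \<open>E\<close> nonempty, as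
    \<open>from_nat_into\<close> requires.\<close>
  obtain e0 :: "'a \<Rightarrow> real" where "test_function e0"
    using test_function_nonzero[OF lc] by metis
  define E where "E = insert e0 (E1 \<union> E2)"
  have E: "countable E" "E \<noteq> {}" "E \<subseteq> Collect test_function"
    using E1 E2 \<open>test_function e0\<close> by (auto simp: E_def)
  show ?thesis
  proof (rule that[of "from_nat_into E"])
    show "test_function (from_nat_into E n)" for n
      using E from_nat_into[of E n] by auto
    show "\<exists>n. from_nat_into E n x \<noteq> 0" for x
    proof -
      obtain e where "test_function e" "e x \<noteq> 0"
        using test_function_nonzero[OF lc] by metis
      then have "x \<in> N e" "N e \<in> N ` Collect test_function" by (auto simp: N_def)
      then have "x \<in> \<Union>F" unfolding F(3) by blast
      then obtain e' where "e' \<in> E" "e' x \<noteq> 0" using E1 by (auto simp: N_def E_def)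
      then show ?thesis using E from_nat_into_surj by metis
    qed
    show "\<exists>n. from_nat_into E n x \<noteq> from_nat_into E n y" if "x \<noteq> y" for x y
    proof -
      obtain e where "test_function e" "e x \<noteq> 0" "e y = 0"
        using test_function_separates[OF lc \<open>x \<noteq> y\<close>] by metis
      then have "(x, y) \<in> W e" "W e \<in> W ` Collect test_function" by (auto simp: W_def)
      then have "(x, y) \<in> \<Union>G" unfolding G(3) by blast
      then obtain e' where "e' \<in> E" "e' x \<noteq> e' y" using E2 by (auto simp: W_def E_def)
      then show ?thesis using E from_nat_into_surj by metis
    qed
  qed
qed

section \<open>Uniform approximation by polynomials in the generators\<close>

lemma compact_sum_squares_pos:
  fixes e :: "nat \<Rightarrow> 'a::topological_space \<Rightarrow> real"
  assumes "compact K" "\<And>n. continuous_on UNIV (e n)" "\<And>x. \<exists>n. e n x \<noteq> 0"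
  obtains N where "\<And>x. x \<in> K \<Longrightarrow> 0 < (\<Sum>n<N. e n x * e n x)"
proof -
  have "open {x. e n x \<noteq> 0}" for n
    using assms by (intro open_Collect_neq) auto
  moreover have "K \<subseteq> (\<Union>n. {x. e n x \<noteq> 0})" using assms by auto
  ultimately obtain I where I: "finite I" "K \<subseteq> (\<Union>n\<in>I. {x. e n x \<noteq> 0})"
    using \<open>compact K\<close> compactE_image[of K UNIV "\<lambda>n. {x. e n x \<noteq> 0}"] by (metis (lifting) UNIV_I)
  obtain N where N: "I \<subseteq> {..<N}" using I(1) finite_nat_iff_bounded by blast
  show ?thesis
  proof (rule that[of N])
    fix x assume "x \<in> K"
    then obtain n where n: "n < N" "e n x \<noteq> 0" using I N by blast
    then show "0 < (\<Sum>n<N. e n x * e n x)"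
      by (intro sum_pos2[where i = n]) (auto simp: zero_less_mult_iff)
  qed
qed

text \<open>The unital algebra generated by the \<open>e n\<close>. Products are built one generator
  at a time, so that an induction can hand a factor \<open>e n\<close> over to a word standing in
  front; closure under all products is then derived.\<close>

inductive_set ring_span :: "(nat \<Rightarrow> 'a \<Rightarrow> real) \<Rightarrow> ('a \<Rightarrow> real) set" for e
  where const: "(\<lambda>_. c) \<in> ring_span e"
  | gen_mult: "p \<in> ring_span e \<Longrightarrow> (\<lambda>x. e n x * p x) \<in> ring_span e"
  | add: "p \<in> ring_span e \<Longrightarrow> q \<in> ring_span e \<Longrightarrow> (\<lambda>x. p x + q x) \<in> ring_span e"

lemma ring_span_scale: "p \<in> ring_span e \<Longrightarrow> (\<lambda>x. c * p x) \<in> ring_span e"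
proof (induction rule: ring_span.induct)
  case (gen_mult p n)
  then show ?case using ring_span.gen_mult[of "\<lambda>x. c * p x" e n] by (simp add: mult.left_commute)
next
  case (add p q)
  then show ?case
    using ring_span.add[of "\<lambda>x. c * p x" e "\<lambda>x. c * q x"] by (simp add: distrib_left)
qed (rule ring_span.const)

lemma ring_span_mult: "p \<in> ring_span e \<Longrightarrow> q \<in> ring_span e \<Longrightarrow> (\<lambda>x. p x * q x) \<in> ring_span e"
proof (induction rule: ring_span.induct)
  case (const c)
  then show ?case by (rule ring_span_scale)
next
  case (gen_mult p n)
  then show ?case using ring_span.gen_mult[of "\<lambda>x. p x * q x" e n] by (simp add: mult.assoc)
next
  case (add p p')
  then show ?case
    using ring_span.add[of "\<lambda>x. p x * q x" e "\<lambda>x. p' x * q x"] by (simp add: distrib_right)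
qed

lemma ring_span_continuous:
  "p \<in> ring_span e \<Longrightarrow> (\<And>n. continuous_on S (e n)) \<Longrightarrow> continuous_on S p"
  by (induction rule: ring_span.induct) (auto intro: continuous_intros)

text \<open>
  Stone--Weierstrass on the compact support of \<open>\<rho>\<close> gives \<open>p \<approx> f / \<rho>\<close> there; outside that
  support both \<open>\<rho> p\<close> and \<open>f\<close> vanish, so \<open>\<rho> p \<approx> f\<close> globally.
\<close>

lemma test_function_approx:
  fixes e :: "nat \<Rightarrow> 'a::t2_space \<Rightarrow> real"
  assumes e: "\<And>n. test_function (e n)" "\<And>x. \<exists>n. e n x \<noteq> 0" "\<And>x y. x \<noteq> y \<Longrightarrow> \<exists>n. e n x \<noteq> e n y"
    and f: "test_function f" and "0 < \<epsilon>"
  obtains p N where "p \<in> ring_span e" "\<And>x. \<bar>f x - (\<Sum>n<N. e n x * e n x) * p x\<bar> \<le> \<epsilon>"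
proof -
  have ce: "continuous_on S (e n)" for S n
    using e(1) test_function_continuous continuous_on_subset by blast
  have cf: "continuous_on S f" for S
    using f test_function_continuous continuous_on_subset by blast
  define K where "K = closure {y. f y \<noteq> 0}"
  \<comment> \<open>This sum is a cut-off made of generators: squares cannot cancel, so it is
    positive on \<open>K\<close> and may be divided by there.\<close>
  obtain N where N: "\<And>x. x \<in> K \<Longrightarrow> 0 < (\<Sum>n<N. e n x * e n x)"
    using compact_sum_squares_pos[of K e] f ce e(2) by (auto simp: K_def test_function_def)
  define \<rho> where "\<rho> x = (\<Sum>n<N. e n x * e n x)" for x
  have c\<rho>: "continuous_on S \<rho>" for S
    unfolding \<rho>_def by (intro continuous_intros ce)
  have "test_function \<rho>"
    unfolding \<rho>_def by (intro test_function_sum test_function_mult e ce) auto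
  then obtain C where C: "0 < C" "\<And>y. \<bar>\<rho> y\<bar> \<le> C"
    using test_function_bounded by metis
  have f0: "f x = 0" if "x \<notin> K" for x
    using that in_support[of f x] by (auto simp: K_def)
  \<comment> \<open>Off \<open>K\<close> the quotient is 0 because \<open>f\<close> is, even where
    \<open>\<rho>\<close> vanishes and division returns its default 0. Positivity of
    \<open>\<rho>\<close> on \<open>K\<close> makes the two open sets cover the space.\<close>
  have "continuous_on ({x. \<rho> x \<noteq> 0} \<union> - K) (\<lambda>x. f x / \<rho> x)"
  proof (rule continuous_on_open_Un)
    show "open {x. \<rho> x \<noteq> 0}" by (intro open_Collect_neq c\<rho>) auto
    show "open (- K)" by (auto simp: K_def)
    show "continuous_on {x. \<rho> x \<noteq> 0} (\<lambda>x. f x / \<rho> x)"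
      by (intro continuous_on_divide cf c\<rho>) auto
    show "continuous_on (- K) (\<lambda>x. f x / \<rho> x)"
      using f0 by (subst continuous_on_cong[where g = "\<lambda>_. 0"]) auto
  qed
  moreover have "{x. \<rho> x \<noteq> 0} \<union> - K = UNIV"
    using N by (force simp: \<rho>_def)
  ultimately have cont: "continuous_on UNIV (\<lambda>x. f x / \<rho> x)" by simp
  interpret function_ring_on "ring_span e" "closure {y. \<rho> y \<noteq> 0}"
  proof
    show "compact (closure {y. \<rho> y \<noteq> 0})"
      using \<open>test_function \<rho>\<close> by (simp add: test_function_def)
    show "\<exists>f\<in>ring_span e. f x \<noteq> f y" if "x \<noteq> y" for x y
    proof -
      obtain n where "e n x \<noteq> e n y" using e(3) \<open>x \<noteq> y\<close> by blast
      moreover have "(\<lambda>x. e n x * 1) \<in> ring_span e"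
        by (intro ring_span.gen_mult ring_span.const)
      ultimately show ?thesis by (intro bexI[of _ "\<lambda>x. e n x * 1"]) auto
    qed
  qed (auto intro: ring_span.intros ring_span_mult ring_span_continuous ce)
  \<comment> \<open>The tolerance \<open>\<epsilon> / C\<close> anticipates the multiplication by
    \<open>\<rho>\<close>, which is at most \<open>C\<close>.\<close>
  obtain p where p: "p \<in> ring_span e" "\<And>x. x \<in> closure {y. \<rho> y \<noteq> 0} \<Longrightarrow> \<bar>f x / \<rho> x - p x\<bar> < \<epsilon> / C"
    using Stone_Weierstrass_basic[of "\<lambda>x. f x / \<rho> x" "\<epsilon> / C"] cont \<open>0 < \<epsilon>\<close> C(1)
    by (metis (no_types, lifting) continuous_on_subset divide_pos_pos subset_UNIV)
  show ?thesis
  proof (rule that[OF p(1), of N])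
    fix x
    show "\<bar>f x - (\<Sum>n<N. e n x * e n x) * p x\<bar> \<le> \<epsilon>"
    proof (cases "\<rho> x = 0")
      case True
      then have "x \<notin> K" using N by (force simp: \<rho>_def)
      then show ?thesis using f0 True \<open>0 < \<epsilon>\<close> by (simp add: \<rho>_def)
    next
      case False
      then have "x \<in> closure {y. \<rho> y \<noteq> 0}" by (rule in_support)
      then have "\<bar>f x / \<rho> x - p x\<bar> \<le> \<epsilon> / C" using p(2) by force
      then have "\<bar>\<rho> x\<bar> * \<bar>f x / \<rho> x - p x\<bar> \<le> C * (\<epsilon> / C)"
        using C \<open>0 < \<epsilon>\<close> by (intro mult_mono) auto
      moreover have "f x - \<rho> x * p x = \<rho> x * (f x / \<rho> x - p x)"
        using False by (simp add: field_simps)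
      ultimately show ?thesis using C by (simp add: abs_mult flip: \<rho>_def)
    qed
  qed
qed

section \<open>Weak* convergence tested on countably many integrals\<close>

lemma integrable_bounded_continuous:
  fixes f :: "'a::topological_space \<Rightarrow> real"
  assumes "prob_space N" "sets N = sets borel" "continuous_on UNIV f" "\<And>y. \<bar>f y\<bar> \<le> C"
  shows "integrable N f"
proof -
  interpret prob_space N by fact
  have "f \<in> borel_measurable N"
    using borel_measurable_continuous_onI[OF assms(3)] measurable_cong_sets[OF assms(2) refl] by blast
  then show ?thesis
    using assms(4) by (intro integrable_const_bound[where B = C]) auto
qed

lemma integrable_test_function:
  assumes "prob_space N" "sets N = sets borel" "test_function f"
  shows "integrable N f"
  using assms integrable_bounded_continuous test_function_bounded test_function_continuous by metis

text \<open>Monomials in the generators, of which there are countably many. The empty word is the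
  constant 1, which need not have compact support; hence the recurring condition
  \<open>ws \<noteq> []\<close>.\<close>

abbreviation word :: "(nat \<Rightarrow> 'a \<Rightarrow> real) \<Rightarrow> nat list \<Rightarrow> 'a \<Rightarrow> real"
  where "word e ws y \<equiv> prod_list (map (\<lambda>n. e n y) ws)"

lemma test_function_word_mult:
  fixes e :: "nat \<Rightarrow> 'a::t2_space \<Rightarrow> real"
  assumes e: "\<And>n. test_function (e n)" and "continuous_on UNIV p" and "ws \<noteq> []"
  shows "test_function (\<lambda>y. word e ws y * p y)"
  using \<open>ws \<noteq> []\<close>
proof (induction ws rule: list_nonempty_induct)
  case (single n)
  then show ?case using assms by (simp add: test_function_mult)
next
  case (cons n ws)
  then show ?case
    using test_function_mult[OF e[of n] test_function_continuous] by (simp add: mult.assoc)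
qed

text \<open>A test function is uniformly close to a sum of words \<open>[n, n]\<close> times an
  element of \<open>ring_span e\<close>, and such products expand into nonempty words. A uniform
  error passes unchanged through integrals against probability measures.\<close>

lemma weak_star_limitI_words:
  fixes e :: "nat \<Rightarrow> 'a::t2_space \<Rightarrow> real" and N :: "'i \<Rightarrow> 'a measure"
  assumes e: "\<And>n. test_function (e n)" "\<And>x. \<exists>n. e n x \<noteq> 0" "\<And>x y. x \<noteq> y \<Longrightarrow> \<exists>n. e n x \<noteq> e n y"
    and \<mu>: "prob_space \<mu>" "sets \<mu> = sets borel"
    and N: "eventually (\<lambda>i. prob_space (N i) \<and> sets (N i) = sets borel) F"
    and lim: "\<And>ws. ws \<noteq> [] \<Longrightarrow> ((\<lambda>i. \<integral>y. word e ws y \<partial>N i) \<longlongrightarrow> (\<integral>y. word e ws y \<partial>\<mu>)) F"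
  shows "weak_star_limit N \<mu> F"
proof -
  have ce: "continuous_on UNIV (e n)" for n
    using e(1) by (rule test_function_continuous)
  \<comment> \<open>The word stays arbitrary in the induction: a factor \<open>e n\<close> of the
    polynomial is absorbed as a new letter.\<close>
  have span: "((\<lambda>i. \<integral>y. word e ws y * p y \<partial>N i) \<longlongrightarrow> (\<integral>y. word e ws y * p y \<partial>\<mu>)) F"
    if "p \<in> ring_span e" "ws \<noteq> []" for p ws
    using that
  proof (induction arbitrary: ws rule: ring_span.induct)
    case (const c)
    then show ?case using lim[of ws] by (auto intro: tendsto_intros)
  next
    case (gen_mult p n)
    then show ?case using gen_mult.IH[of "n # ws"] by (simp add: ac_simps)
  next
    case (add p q)
    have t: "test_function (\<lambda>y. word e ws y * p y)" "test_function (\<lambda>y. word e ws y * q y)"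
      using add.hyps add.prems by (auto intro: test_function_word_mult[OF e(1)] ring_span_continuous[OF _ ce])
    have *: "(\<integral>y. word e ws y * (p y + q y) \<partial>M) = (\<integral>y. word e ws y * p y \<partial>M) + (\<integral>y. word e ws y * q y \<partial>M)"
      if "prob_space M \<and> sets M = sets borel" for M
      using that t by (simp add: distrib_left integrable_test_function)
    have "((\<lambda>i. (\<integral>y. word e ws y * p y \<partial>N i) + (\<integral>y. word e ws y * q y \<partial>N i)) \<longlongrightarrow>
        (\<integral>y. word e ws y * p y \<partial>\<mu>) + (\<integral>y. word e ws y * q y \<partial>\<mu>)) F"
      using add by (intro tendsto_add) auto
    then show ?case
      using * \<mu> N by (subst tendsto_cong[OF eventually_mono[OF N]]) auto
  qed
  have "((\<lambda>i. \<integral>y. f y \<partial>N i) \<longlongrightarrow> (\<integral>y. f y \<partial>\<mu>)) F" if f: "test_function f" for f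
  proof (rule tendstoI)
    fix \<epsilon> :: real assume "0 < \<epsilon>"
    obtain p k where p: "p \<in> ring_span e"
      and approx: "\<And>x. \<bar>f x - (\<Sum>n<k. e n x * e n x) * p x\<bar> \<le> \<epsilon> / 4"
      using test_function_approx[OF e f, of "\<epsilon> / 4"] \<open>0 < \<epsilon>\<close> by auto
    define g where "g x = (\<Sum>n<k. word e [n, n] x * p x)" for x
    have gp: "test_function (\<lambda>x. word e [n, n] x * p x)" for n
      using p by (intro test_function_word_mult e(1) ring_span_continuous[OF _ ce]) auto
    have g: "test_function g"
      unfolding g_def by (intro test_function_sum gp) auto
    have fg: "\<bar>f x - g x\<bar> \<le> \<epsilon> / 4" for x
      using approx[of x] by (simp add: g_def sum_distrib_right)
    have close: "\<bar>(\<integral>y. f y \<partial>M) - (\<integral>y. g y \<partial>M)\<bar> \<le> \<epsilon> / 4"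
      if M: "prob_space M \<and> sets M = sets borel" for M
    proof -
      interpret prob_space M using M by simp
      have i: "integrable M f" "integrable M g" using M f g integrable_test_function by auto
      then have "\<bar>(\<integral>y. f y \<partial>M) - (\<integral>y. g y \<partial>M)\<bar> = \<bar>\<integral>y. f y - g y \<partial>M\<bar>" by simp
      also have "\<dots> \<le> (\<integral>y. \<bar>f y - g y\<bar> \<partial>M)" by (rule integral_abs_bound)
      also have "\<dots> \<le> \<epsilon> / 4" using i fg by (intro integral_le_const) auto
      finally show ?thesis .
    qed
    have gsum: "(\<integral>y. g y \<partial>M) = (\<Sum>n<k. \<integral>y. word e [n, n] y * p y \<partial>M)"
      if "prob_space M \<and> sets M = sets borel" for M
      unfolding g_def using that gp by (intro Bochner_Integration.integral_sum integrable_test_function) auto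
    have "((\<lambda>i. \<Sum>n<k. \<integral>y. word e [n, n] y * p y \<partial>N i) \<longlongrightarrow>
        (\<Sum>n<k. \<integral>y. word e [n, n] y * p y \<partial>\<mu>)) F"
      by (intro tendsto_sum span p) auto
    then have "\<forall>\<^sub>F i in F. dist (\<Sum>n<k. \<integral>y. word e [n, n] y * p y \<partial>N i)
        (\<Sum>n<k. \<integral>y. word e [n, n] y * p y \<partial>\<mu>) < \<epsilon> / 4"
      using \<open>0 < \<epsilon>\<close> tendstoD zero_less_divide_iff zero_less_numeral by blast
    with N show "\<forall>\<^sub>F i in F. dist (\<integral>y. f y \<partial>N i) (\<integral>y. f y \<partial>\<mu>) < \<epsilon>"
    proof eventually_elim
      case (elim i)
      have "\<bar>(\<integral>y. g y \<partial>N i) - (\<integral>y. g y \<partial>\<mu>)\<bar> < \<epsilon> / 4"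
        using elim \<mu> gsum by (simp add: dist_real_def)
      moreover have "\<bar>(\<integral>y. f y \<partial>N i) - (\<integral>y. g y \<partial>N i)\<bar> \<le> \<epsilon> / 4"
        using close elim by blast
      moreover have "\<bar>(\<integral>y. f y \<partial>\<mu>) - (\<integral>y. g y \<partial>\<mu>)\<bar> \<le> \<epsilon> / 4"
        using close \<mu> by blast
      ultimately show ?case unfolding dist_real_def using \<open>0 < \<epsilon>\<close> by argo
    qed
  qed
  then show ?thesis
    unfolding weak_star_limit_def test_function_def by blast
qed

section \<open>Full mass of the limit and bounded continuous integrands\<close>

lemma tight_test_function:
  fixes \<mu> :: "'a::{second_countable_topology, t2_space} measure"
  assumes lc: "locally_compact_space (euclidean :: 'a topology)"
    and \<mu>: "prob_space \<mu>" "sets \<mu> = sets borel" and "0 < \<epsilon>"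
  obtains \<psi> where "test_function \<psi>" "\<And>y. 0 \<le> \<psi> y" "\<And>y. \<psi> y \<le> 1" "1 - \<epsilon> < (\<integral>y. \<psi> y \<partial>\<mu>)"
proof -
  interpret prob_space \<mu> by fact
  obtain e :: "nat \<Rightarrow> 'a \<Rightarrow> real" where e: "\<And>n. test_function (e n)" "\<And>x. \<exists>n. e n x \<noteq> 0"
    using countable_test_functions[OF lc] by metis
  define s where "s k y = (\<Sum>n<k. e n y * e n y)" for k y
  \<comment> \<open>Where some \<open>e n\<close> is nonzero, \<open>s k\<close> stays bounded below
    for large \<open>k\<close>, so the factor \<open>real k\<close> lifts it above 1 and the minimum
    becomes exactly 1. Dominated convergence then gives nearly full mass.\<close>
  define \<psi> where "\<psi> k y = min 1 (real k * s k y)" for k y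
  have ts: "test_function (s k)" for k
    unfolding s_def by (intro test_function_sum test_function_mult e(1) test_function_continuous) auto
  have t: "test_function (\<psi> k)" for k
  proof (rule test_functionI)
    show "compact (closure {y. s k y \<noteq> 0})" using ts by (simp add: test_function_def)
    show "y \<in> closure {y. s k y \<noteq> 0}" if "\<psi> k y \<noteq> 0" for y
      using that by (intro in_support) (auto simp: \<psi>_def)
    show "continuous_on UNIV (\<psi> k)"
      unfolding \<psi>_def using ts[of k, THEN test_function_continuous] by (intro continuous_intros)
  qed
  have s0: "0 \<le> s k y" for k y by (auto simp: s_def intro: sum_nonneg)
  have b: "0 \<le> \<psi> k y" "\<psi> k y \<le> 1" for k y using s0 by (auto simp: \<psi>_def)
  have "(\<lambda>k. \<psi> k y) \<longlonglongrightarrow> 1" for y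
  proof -
    obtain n where n: "e n y \<noteq> 0" using e by blast
    have "\<forall>\<^sub>F k in sequentially. \<psi> k y = 1"
    proof (rule eventually_sequentiallyI)
      fix k assume k: "max (Suc n) (nat \<lceil>1 / (e n y * e n y)\<rceil>) \<le> k"
      have pos: "0 < e n y * e n y" using n by (metis not_real_square_gt_zero)
      have "e n y * e n y \<le> s k y"
        unfolding s_def using k by (intro member_le_sum[where i = n]) auto
      moreover have "1 / (e n y * e n y) \<le> real k" using k by linarith
      ultimately have "1 / (e n y * e n y) * (e n y * e n y) \<le> real k * s k y"
        using pos by (intro mult_mono) auto
      then show "\<psi> k y = 1" using pos n by (simp add: \<psi>_def)
    qed
    then show ?thesis by (rule tendsto_eventually)
  qed
  moreover have "\<psi> k \<in> borel_measurable \<mu>" for k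
    using integrable_test_function[OF \<mu> t] by auto
  ultimately have "(\<lambda>k. \<integral>y. \<psi> k y \<partial>\<mu>) \<longlonglongrightarrow> (\<integral>y. 1 \<partial>\<mu>)"
    using b by (intro integral_dominated_convergence[where w = "\<lambda>_. 1"]) auto
  then have "\<forall>\<^sub>F k in sequentially. 1 - \<epsilon> < (\<integral>y. \<psi> k y \<partial>\<mu>)"
    using \<open>0 < \<epsilon>\<close> by (intro order_tendstoD) (auto simp: prob_space)
  then obtain k where "1 - \<epsilon> < (\<integral>y. \<psi> k y \<partial>\<mu>)"
    using eventually_happens by fastforce
  then show ?thesis using that t b by blast
qed

text \<open>
  Since \<open>\<mu>\<close> has full mass, no mass escapes to infinity, which extends one half of the convergence
  from compactly supported functions to bounded ones.
\<close>

lemma weak_star_limit_upper_bound: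
  fixes \<mu> :: "'a::{second_countable_topology, t2_space} measure"
    and u :: "'a \<Rightarrow> real"
  assumes lc: "locally_compact_space (euclidean :: 'a topology)"
    and \<mu>: "prob_space \<mu>" "sets \<mu> = sets borel"
    and N: "eventually (\<lambda>i. prob_space (N i) \<and> sets (N i) = sets borel) F"
    and lim: "weak_star_limit N \<mu> F"
    and u: "continuous_on UNIV u" "\<And>y. 0 \<le> u y" "\<And>y. u y \<le> B" and "0 < \<epsilon>"
  shows "eventually (\<lambda>i. (\<integral>y. u y \<partial>N i) < (\<integral>y. u y \<partial>\<mu>) + \<epsilon>) F"
proof -
  have "0 \<le> B" using u(2,3)[of undefined] by linarith
  \<comment> \<open>\<open>B + 1\<close> avoids division by zero when \<open>B = 0\<close>.\<close>
  define \<delta> where "\<delta> = \<epsilon> / (2 * (B + 1))"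
  have "0 < \<delta>" and B\<delta>: "B * \<delta> < \<epsilon> / 2"
    using \<open>0 \<le> B\<close> \<open>0 < \<epsilon>\<close> by (auto simp: \<delta>_def field_simps)
  obtain \<psi> where \<psi>: "test_function \<psi>" "\<And>y. 0 \<le> \<psi> y" "\<And>y. \<psi> y \<le> 1" "1 - \<delta> < (\<integral>y. \<psi> y \<partial>\<mu>)"
    using tight_test_function[OF lc \<mu> \<open>0 < \<delta>\<close>] by metis
  have \<psi>u: "test_function (\<lambda>y. \<psi> y * u y)"
    by (intro test_function_mult \<psi> u)
  \<comment> \<open>These are the integrals of \<open>\<psi> u + B (1 - \<psi>)\<close>, a majorant
    of \<open>u\<close> built from compactly supported functions and the total mass.\<close>
  have "((\<lambda>i. (\<integral>y. \<psi> y * u y \<partial>N i) + B * (1 - (\<integral>y. \<psi> y \<partial>N i))) \<longlongrightarrow>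
      (\<integral>y. \<psi> y * u y \<partial>\<mu>) + B * (1 - (\<integral>y. \<psi> y \<partial>\<mu>))) F"
    using lim \<psi>(1) \<psi>u unfolding weak_star_limit_def test_function_def by (intro tendsto_intros) auto
  moreover have "(\<integral>y. \<psi> y * u y \<partial>\<mu>) + B * (1 - (\<integral>y. \<psi> y \<partial>\<mu>)) < (\<integral>y. u y \<partial>\<mu>) + \<epsilon>"
  proof -
    have "(\<integral>y. \<psi> y * u y \<partial>\<mu>) \<le> (\<integral>y. u y \<partial>\<mu>)"
      using \<psi>(2,3) u \<mu> \<psi>u
      by (intro integral_mono integrable_test_function integrable_bounded_continuous[where C = B])
         (auto simp: mult_left_le_one_le)
    moreover have "B * (1 - (\<integral>y. \<psi> y \<partial>\<mu>)) \<le> B * \<delta>"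
      using \<psi>(4) \<open>0 \<le> B\<close> by (intro mult_left_mono) auto
    ultimately show ?thesis using B\<delta> \<open>0 < \<epsilon>\<close> by linarith
  qed
  ultimately have "\<forall>\<^sub>F i in F. (\<integral>y. \<psi> y * u y \<partial>N i) + B * (1 - (\<integral>y. \<psi> y \<partial>N i)) < (\<integral>y. u y \<partial>\<mu>) + \<epsilon>"
    by (rule order_tendstoD)
  with N show ?thesis
  proof eventually_elim
    case (elim i)
    interpret prob_space "N i" using elim by simp
    have i: "integrable (N i) u" "integrable (N i) \<psi>" "integrable (N i) (\<lambda>y. \<psi> y * u y)"
      using elim u \<psi> \<psi>u
      by (auto intro: integrable_test_function integrable_bounded_continuous[where C = B])
    have "(\<integral>y. u y \<partial>N i) \<le> (\<integral>y. \<psi> y * u y + B * (1 - \<psi> y) \<partial>N i)"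
    proof (rule integral_mono)
      fix y
      have "(1 - \<psi> y) * u y \<le> (1 - \<psi> y) * B"
        using u \<psi> by (intro mult_left_mono) auto
      then show "u y \<le> \<psi> y * u y + B * (1 - \<psi> y)" by (simp add: algebra_simps)
    qed (use i in auto)
    also have "\<dots> = (\<integral>y. \<psi> y * u y \<partial>N i) + B * (1 - (\<integral>y. \<psi> y \<partial>N i))"
      using i by (simp add: prob_space)
    finally show ?case using elim by linarith
  qed
qed

section \<open>The mean ergodic theorem\<close>

lemma AE_summable_integrable:
  fixes u :: "nat \<Rightarrow> 'a \<Rightarrow> real"
  assumes i: "\<And>n. integrable M (u n)" and nonneg: "\<And>n x. 0 \<le> u n x"
    and s: "summable (\<lambda>n. \<integral>x. u n x \<partial>M)"
  shows "AE x in M. summable (\<lambda>n. u n x)"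
proof -
  note [measurable] = borel_measurable_integrable[OF i]
  have "(\<integral>\<^sup>+x. (\<Sum>n. ennreal (u n x)) \<partial>M) = (\<Sum>n. \<integral>\<^sup>+x. ennreal (u n x) \<partial>M)"
    by (intro nn_integral_suminf) measurable
  also have "\<dots> = (\<Sum>n. ennreal (\<integral>x. u n x \<partial>M))"
    using i nonneg by (subst nn_integral_eq_integral) auto
  also have "\<dots> \<noteq> top"
    using s nonneg by (simp add: ennreal_suminf_neq_top)
  finally have "AE x in M. (\<Sum>n. ennreal (u n x)) \<noteq> \<infinity>"
    by (intro nn_integral_PInf_AE) auto
  then show ?thesis
    by eventually_elim (use nonneg in \<open>auto intro: summable_suminf_not_top\<close>)
qed

text \<open>Pointwise AM--GM with weights \<open>2\<^sup>n\<close> turns summability of the squared norms into summability a.e.\<close>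

lemma AE_summable_of_square:
  fixes u :: "nat \<Rightarrow> 'a \<Rightarrow> real"
  assumes i: "\<And>n. integrable M (\<lambda>x. (u n x)\<^sup>2)"
    and b: "\<And>n. (\<integral>x. (u n x)\<^sup>2 \<partial>M) \<le> C * (1 / 4) ^ n"
  shows "AE x in M. summable (\<lambda>n. \<bar>u n x\<bar>)"
proof -
  have "AE x in M. summable (\<lambda>n. 2 ^ n * (u n x)\<^sup>2)"
  proof (rule AE_summable_integrable)
    show "summable (\<lambda>n. \<integral>x. 2 ^ n * (u n x)\<^sup>2 \<partial>M)"
    proof (rule summable_comparison_test)
      have "(\<integral>x. 2 ^ n * (u n x)\<^sup>2 \<partial>M) \<le> C * (1 / 2) ^ n" for n
      proof -
        have "2 ^ n * (\<integral>x. (u n x)\<^sup>2 \<partial>M) \<le> 2 ^ n * (C * (1 / 4) ^ n)"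
          by (intro mult_left_mono b) auto
        also have "\<dots> = C * (2 * (1 / 4)) ^ n"
          by (simp only: power_mult_distrib ac_simps)
        finally show ?thesis by simp
      qed
      then show "\<exists>N. \<forall>n\<ge>N. norm (\<integral>x. 2 ^ n * (u n x)\<^sup>2 \<partial>M) \<le> C * (1 / 2) ^ n"
        by auto
      show "summable (\<lambda>n. C * (1 / 2) ^ n)"
        by (intro summable_mult summable_geometric) auto
    qed
  qed (use i in auto)
  then show ?thesis
  proof eventually_elim
    case (elim x)
    show ?case
    proof (rule summable_comparison_test)
      have "\<bar>u n x\<bar> \<le> 2 ^ n * (u n x)\<^sup>2 + (1 / 2) ^ n" for n
      proof -
        have "0 \<le> (2 ^ n * \<bar>u n x\<bar> - 1 / 2)\<^sup>2 / 2 ^ n" by simp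
        also have "\<dots> = 2 ^ n * (u n x)\<^sup>2 - \<bar>u n x\<bar> + 1 / 4 * (1 / 2) ^ n"
          by (simp add: power2_diff power_mult_distrib field_simps power2_eq_square)
        finally show ?thesis
          using zero_le_power[of "1 / 2 :: real" n] by linarith
      qed
      then show "\<exists>N. \<forall>n\<ge>N. norm \<bar>u n x\<bar> \<le> 2 ^ n * (u n x)\<^sup>2 + (1 / 2) ^ n" by auto
      show "summable (\<lambda>n. 2 ^ n * (u n x)\<^sup>2 + (1 / 2) ^ n)"
        by (intro summable_add elim summable_geometric) auto
    qed
  qed
qed

lemma AE_lborel_shift:
  assumes [measurable]: "Measurable.pred borel P"
  shows "(AE t in lborel. P (t + s :: real)) \<longleftrightarrow> (AE t in lborel. P t)"
proof -
  have "(AE t in distr lborel borel ((+) s). P t) \<longleftrightarrow> (AE t in lborel. P (s + t))"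
    by (intro AE_distr_iff) auto
  then show ?thesis unfolding lborel_distr_plus by (simp add: add.commute[of s])
qed

locale ergodic_flow =
  fixes \<phi> :: "real \<Rightarrow> 'a \<Rightarrow> 'a::{second_countable_topology, t2_space}" and \<mu> :: "'a measure"
  assumes flow_continuous: "continuous_on UNIV (\<lambda>(t, y). \<phi> t y)"
    and flow_add: "\<phi> (s + t) y = \<phi> s (\<phi> t y)"
    and ergodic: "flow_ergodic \<phi> \<mu>"
begin

lemma sets_\<mu> [simp, measurable_cong]: "sets \<mu> = sets borel"
  using ergodic by (simp add: flow_ergodic_def)

lemma space_\<mu> [simp]: "space \<mu> = UNIV"
  using sets_eq_imp_space_eq[OF sets_\<mu>] by simp

sublocale prob_space \<mu>
  using ergodic by (simp add: flow_ergodic_def)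

lemma measure_UNIV [simp]: "prob UNIV = 1" "emeasure \<mu> UNIV = 1"
  using prob_space emeasure_space_1 by simp_all

lemma distr_flow: "distr \<mu> borel (\<phi> t) = \<mu>"
  using ergodic by (simp add: flow_ergodic_def)

text \<open>Second countability identifies the product of the Borel algebras with the Borel algebra
  of the product, so joint continuity gives the joint measurability on which Fubini along orbits
  rests.\<close>

lemma measurable_flow_pair [measurable]: "(\<lambda>(t, y). \<phi> t y) \<in> borel \<Otimes>\<^sub>M borel \<rightarrow>\<^sub>M borel"
  unfolding borel_prod using flow_continuous by (rule borel_measurable_continuous_onI)

lemma continuous_flow_comp:
  assumes "continuous_on S f" "continuous_on S g"
  shows "continuous_on S (\<lambda>z. \<phi> (f z) (g z))"
  using continuous_on_compose2[OF flow_continuous, of S "\<lambda>z. (f z, g z)"] assms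
  by (simp add: continuous_on_Pair)

lemma measurable_flow [measurable]: "\<phi> t \<in> borel \<rightarrow>\<^sub>M borel"
  by (intro borel_measurable_continuous_onI continuous_flow_comp continuous_intros)

lemma integral_flow:
  fixes f :: "'a \<Rightarrow> real"
  assumes [measurable]: "f \<in> borel_measurable borel"
  shows "(\<integral>y. f (\<phi> t y) \<partial>\<mu>) = (\<integral>y. f y \<partial>\<mu>)"
  using integral_distr[of "\<phi> t" \<mu> borel f] by (simp add: distr_flow)

text \<open>
  Invariance up to null sets for each time separately is upgraded to strict invariance by passing
  to the set of points whose orbit spends almost all times in \<open>{c < G}\<close>.
\<close>

lemma AE_invariant_zero_one:
  fixes G :: "'a \<Rightarrow> real"
  assumes G [measurable]: "G \<in> borel_measurable borel"
    and inv: "\<And>s. AE y in \<mu>. G (\<phi> s y) = G y"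
  shows "(AE y in \<mu>. c < G y) \<or> (AE y in \<mu>. G y \<le> c)"
proof -
  interpret lp: pair_sigma_finite lborel \<mu>
    by unfold_locales
  define A where "A = {y. AE t in lborel. c < G (\<phi> t y)}"
  have A_emeasure: "A = {y. emeasure lborel {t. \<not> c < G (\<phi> t y)} = 0}"
    unfolding A_def by (intro Collect_cong AE_iff_measurable) auto
  have [measurable]: "A \<in> sets borel"
  proof -
    have "{y \<in> space borel. emeasure lborel {t. \<not> c < G (\<phi> t y)} = 0} \<in> sets borel"
      by measurable
    then show ?thesis by (simp add: A_emeasure)
  qed
  \<comment> \<open>Moving \<open>y\<close> by \<open>\<phi> s\<close> translates the set of times,
    and Lebesgue null sets are translation invariant, so the invariance of \<open>A\<close> is
    exact.\<close>
  have "\<phi> s -` A = A" for s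
  proof -
    have "(AE t in lborel. c < G (\<phi> (t + s) y)) \<longleftrightarrow> (AE t in lborel. c < G (\<phi> t y))" for y
      by (rule AE_lborel_shift) measurable
    then show ?thesis by (auto simp: A_def flow_add)
  qed
  then have "measure \<mu> A = 0 \<or> measure \<mu> A = 1"
    using ergodic \<open>A \<in> sets borel\<close> unfolding flow_ergodic_def by blast
  then have zo: "(AE y in \<mu>. y \<notin> A) \<or> (AE y in \<mu>. y \<in> A)"
    by (auto simp: prob_eq_0 prob_eq_1)
  have "AE t in lborel. AE y in \<mu>. G (\<phi> t y) = G y"
    using inv by simp
  \<comment> \<open>Fubini trades a null set for each time for a single null set of points; off it,
    membership in \<open>A\<close> just says \<open>c < G y\<close>.\<close>
  then have "AE y in \<mu>. AE t in lborel. G (\<phi> t y) = G y"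
    by (subst (asm) lp.AE_commute) measurable
  then have "AE y in \<mu>. y \<in> A \<longleftrightarrow> c < G y"
  proof eventually_elim
    case (elim y)
    have "(AE t in lborel. c < G (\<phi> t y)) \<longleftrightarrow> (AE t in (lborel :: real measure). c < G y)"
      using elim by (intro eventually_cong) auto
    also have "\<dots> \<longleftrightarrow> c < G y"
      by (simp add: eventually_const_iff ae_filter_eq_bot_iff)
    finally show ?case by (simp add: A_def)
  qed
  then have "AE y in \<mu>. (y \<notin> A \<longrightarrow> G y \<le> c) \<and> (y \<in> A \<longrightarrow> c < G y)"
    by eventually_elim auto
  with zo show ?thesis
  proof (elim disjE)
    assume "AE y in \<mu>. y \<notin> A" "AE y in \<mu>. (y \<notin> A \<longrightarrow> G y \<le> c) \<and> (y \<in> A \<longrightarrow> c < G y)"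
    then have "AE y in \<mu>. G y \<le> c" by eventually_elim simp
    then show ?thesis ..
  next
    assume "AE y in \<mu>. y \<in> A" "AE y in \<mu>. (y \<notin> A \<longrightarrow> G y \<le> c) \<and> (y \<in> A \<longrightarrow> c < G y)"
    then have "AE y in \<mu>. c < G y" by eventually_elim simp
    then show ?thesis ..
  qed
qed

text \<open>An integrable function cannot exceed its mean almost everywhere. With the zero-one
  alternative at the level of the mean, for \<open>G\<close> and for \<open>- G\<close>, only
  equality remains.\<close>

lemma AE_invariant_const:
  fixes G :: "'a \<Rightarrow> real"
  assumes G [measurable]: "G \<in> borel_measurable borel" and int: "integrable \<mu> G"
    and inv: "\<And>s. AE y in \<mu>. G (\<phi> s y) = G y"
  shows "AE y in \<mu>. G y = (\<integral>y. G y \<partial>\<mu>)"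
proof -
  let ?m = "\<integral>y. G y \<partial>\<mu>"
  have "\<not> (AE y in \<mu>. ?m < G y)"
  proof
    assume "AE y in \<mu>. ?m < G y"
    then have "(\<integral>y. ?m \<partial>\<mu>) < ?m"
      using int by (intro integral_less_AE_space) auto
    then show False by simp
  qed
  moreover have "\<not> (AE y in \<mu>. - ?m < - G y)"
  proof
    assume "AE y in \<mu>. - ?m < - G y"
    then have "?m < (\<integral>y. ?m \<partial>\<mu>)"
      using int by (intro integral_less_AE_space) auto
    then show False by simp
  qed
  ultimately have "AE y in \<mu>. G y \<le> ?m" "AE y in \<mu>. - G y \<le> - ?m"
    using AE_invariant_zero_one[OF G inv, of ?m] AE_invariant_zero_one[of "\<lambda>y. - G y" "- ?m"] inv
    by auto
  then show ?thesis by eventually_elim auto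
qed

text \<open>
  The mean ergodic theorem in Riesz's form: a sequence minimising the \<open>L\<^sup>2\<close> norm over \<open>K\<close> is
  Cauchy and asymptotically invariant by the parallelogram law, so its limit is invariant, hence
  constant.
\<close>

lemma convex_invariant_near_const:
  fixes K :: "('a \<Rightarrow> real) set"
  assumes "K \<noteq> {}"
    and meas: "\<And>h. h \<in> K \<Longrightarrow> h \<in> borel_measurable borel"
    and bound: "\<And>h y. h \<in> K \<Longrightarrow> \<bar>h y\<bar> \<le> C"
    and mid: "\<And>h k. h \<in> K \<Longrightarrow> k \<in> K \<Longrightarrow> (\<lambda>y. (h y + k y) / 2) \<in> K"
    and shift: "\<And>h s. h \<in> K \<Longrightarrow> (\<lambda>y. h (\<phi> s y)) \<in> K"
    and mean: "\<And>h. h \<in> K \<Longrightarrow> (\<integral>y. h y \<partial>\<mu>) = m"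
    and "0 < \<epsilon>"
  obtains h where "h \<in> K" "(\<integral>y. (h y - m)\<^sup>2 \<partial>\<mu>) < \<epsilon>"
proof -
  have int: "integrable \<mu> (\<lambda>y. (h y)\<^sup>2)" "integrable \<mu> h" if "h \<in> K" for h
  proof -
    note [measurable] = meas[OF that]
    have "\<bar>(h y)\<^sup>2\<bar> \<le> C\<^sup>2" for y
      using bound[OF that, of y] by (simp add: abs_le_square_iff[symmetric])
    then show "integrable \<mu> (\<lambda>y. (h y)\<^sup>2)"
      by (intro integrable_const_bound[where B = "C\<^sup>2"]) auto
    show "integrable \<mu> h"
      using bound[OF that] by (intro integrable_const_bound[where B = C]) auto
  qed
  define I where "I = (INF h\<in>K. \<integral>y. (h y)\<^sup>2 \<partial>\<mu>)"
  have bdd: "bdd_below ((\<lambda>h. \<integral>y. (h y)\<^sup>2 \<partial>\<mu>) ` K)"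
    by (intro bdd_belowI[of _ 0]) auto
  have I_le: "I \<le> (\<integral>y. (h y)\<^sup>2 \<partial>\<mu>)" if "h \<in> K" for h
    unfolding I_def by (intro cINF_lower bdd that)
  \<comment> \<open>The midpoint lies in \<open>K\<close>, so its squared norm is at least
    \<open>I\<close>; the parallelogram law then leaves only the excesses over
    \<open>I\<close>.\<close>
  have para: "integrable \<mu> (\<lambda>y. (h y - k y)\<^sup>2) \<and>
      (\<integral>y. (h y - k y)\<^sup>2 \<partial>\<mu>) \<le> 2 * ((\<integral>y. (h y)\<^sup>2 \<partial>\<mu>) - I) + 2 * ((\<integral>y. (k y)\<^sup>2 \<partial>\<mu>) - I)"
    if "h \<in> K" "k \<in> K" for h k
  proof -
    have eq: "(\<lambda>y. (h y - k y)\<^sup>2) = (\<lambda>y. 2 * (h y)\<^sup>2 + 2 * (k y)\<^sup>2 - 4 * ((h y + k y) / 2)\<^sup>2)"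
      by (rule ext) (simp add: power2_eq_square field_simps)
    have "integrable \<mu> (\<lambda>y. (h y - k y)\<^sup>2)"
      unfolding eq using int that mid by (intro Bochner_Integration.integrable_diff Bochner_Integration.integrable_add
          integrable_mult_right) auto
    moreover have "(\<integral>y. (h y - k y)\<^sup>2 \<partial>\<mu>) =
        2 * (\<integral>y. (h y)\<^sup>2 \<partial>\<mu>) + 2 * (\<integral>y. (k y)\<^sup>2 \<partial>\<mu>) - 4 * (\<integral>y. ((h y + k y) / 2)\<^sup>2 \<partial>\<mu>)"
      unfolding eq using int(1)[OF that(1)] int(1)[OF that(2)] int(1)[OF mid[OF that]] by simp
    ultimately show ?thesis using I_le[OF mid[OF that]] by auto
  qed
  \<comment> \<open>The rate \<open>(1 / 4) ^ n\<close> is the one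
    \<open>AE_summable_of_square\<close> asks for; the sequence then converges almost everywhere
    without passing to a subsequence.\<close>
  have "\<exists>h\<in>K. (\<integral>y. (h y)\<^sup>2 \<partial>\<mu>) < I + (1 / 4) ^ n" for n
    using cINF_less_iff[OF \<open>K \<noteq> {}\<close> bdd, of "I + (1 / 4) ^ n"] by (simp add: I_def)
  then obtain h where h: "h n \<in> K" "(\<integral>y. (h n y)\<^sup>2 \<partial>\<mu>) < I + (1 / 4) ^ n" for n
    by metis
  note [measurable] = meas[OF h(1)]
  have "AE y in \<mu>. summable (\<lambda>n. \<bar>h (Suc n) y - h n y\<bar>)"
  proof (rule AE_summable_of_square)
    show "(\<integral>y. (h (Suc n) y - h n y)\<^sup>2 \<partial>\<mu>) \<le> 4 * (1 / 4) ^ n" for n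
    proof -
      define q :: real where "q = (1 / 4) ^ n"
      have "0 \<le> q" by (simp add: q_def)
      then show ?thesis
        using para[OF h(1) h(1), of "Suc n" n, THEN conjunct2] h(2)[of n] h(2)[of "Suc n"] unfolding power_Suc q_def[symmetric] by argo
    qed
  qed (use para h in auto)
  then have conv: "AE y in \<mu>. convergent (\<lambda>n. h n y)"
  proof eventually_elim
    case (elim y)
    then have "summable (\<lambda>n. h (Suc n) y - h n y)"
      by (intro summable_norm_cancel[of "\<lambda>n. h (Suc n) y - h n y"]) simp
    then have "convergent (\<lambda>n. (\<Sum>i<n. h (Suc i) y - h i y) + h 0 y)"
      by (intro convergent_add convergent_const) (simp add: summable_iff_convergent)
    then show ?case using sum_lessThan_telescope[of "\<lambda>i. h i y"] by simp
  qed
  \<comment> \<open>A translate of \<open>h n\<close> lies in \<open>K\<close> and, by invariance of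
    \<open>\<mu>\<close>, has the same norm. It is therefore equally close to minimal, and
    \<open>para\<close> applies to the pair.\<close>
  have almost_inv: "AE y in \<mu>. (\<lambda>n. h n (\<phi> s y) - h n y) \<longlonglongrightarrow> 0" for s
  proof -
    have "AE y in \<mu>. summable (\<lambda>n. \<bar>h n (\<phi> s y) - h n y\<bar>)"
    proof (rule AE_summable_of_square)
      show "(\<integral>y. (h n (\<phi> s y) - h n y)\<^sup>2 \<partial>\<mu>) \<le> 4 * (1 / 4) ^ n" for n
        using para[OF shift[OF h(1)] h(1), of n s n] h(2)[of n] integral_flow[of "\<lambda>y. (h n y)\<^sup>2" s]
        by auto
    qed (use para h shift in auto)
    then show ?thesis
      by eventually_elim (use summable_LIMSEQ_zero tendsto_rabs_zero_iff in fastforce)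
  qed
  define G where "G y = lim (\<lambda>n. h n y)" for y
  have [measurable]: "G \<in> borel_measurable borel"
    unfolding G_def by measurable
  have lim: "AE y in \<mu>. (\<lambda>n. h n y) \<longlonglongrightarrow> G y"
    using conv by eventually_elim (simp add: G_def convergent_LIMSEQ_iff)
  \<comment> \<open>As \<open>G\<close> is given by \<open>lim\<close> at every point, its value at
    \<open>\<phi> s y\<close> follows from the two limits taken at \<open>y\<close>.\<close>
  have "AE y in \<mu>. G (\<phi> s y) = G y" for s
    using lim almost_inv[of s]
  proof eventually_elim
    case (elim y)
    have "(\<lambda>n. (h n (\<phi> s y) - h n y) + h n y) \<longlonglongrightarrow> 0 + G y"
      using elim by (intro tendsto_add)
    then show ?case by (simp add: G_def limI)
  qed
  moreover have "integrable \<mu> G"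
    by (rule integrable_dominated_convergence[where s = h and w = "\<lambda>_. C"])
       (use lim bound h in auto)
  ultimately have G: "AE y in \<mu>. G y = (\<integral>y. G y \<partial>\<mu>)"
    by (intro AE_invariant_const) auto
  have "(\<lambda>n. \<integral>y. h n y \<partial>\<mu>) \<longlonglongrightarrow> (\<integral>y. G y \<partial>\<mu>)"
    by (rule integral_dominated_convergence[where w = "\<lambda>_. C"])
       (use lim bound h in auto)
  then have "(\<integral>y. G y \<partial>\<mu>) = m"
    using mean h by (simp add: LIMSEQ_const_iff)
  with G lim have "AE y in \<mu>. (\<lambda>n. h n y) \<longlonglongrightarrow> m" by auto
  then have sq: "AE y in \<mu>. (\<lambda>n. (h n y - m)\<^sup>2) \<longlonglongrightarrow> 0"
    by eventually_elim (auto intro!: tendsto_eq_intros)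
  have sq_bound: "\<bar>(h n y - m)\<^sup>2\<bar> \<le> (C + \<bar>m\<bar>)\<^sup>2" for n y
  proof -
    have "\<bar>h n y - m\<bar> \<le> \<bar>C + \<bar>m\<bar>\<bar>"
      using bound[OF h(1), of n y] by linarith
    then show ?thesis by (simp add: abs_le_square_iff)
  qed
  have "(\<lambda>n. \<integral>y. (h n y - m)\<^sup>2 \<partial>\<mu>) \<longlonglongrightarrow> (\<integral>y. 0 \<partial>\<mu>)"
    by (rule integral_dominated_convergence[where w = "\<lambda>_. (C + \<bar>m\<bar>)\<^sup>2"])
       (use sq sq_bound in auto)
  then have "\<forall>\<^sub>F n in sequentially. (\<integral>y. (h n y - m)\<^sup>2 \<partial>\<mu>) < \<epsilon>"
    using \<open>0 < \<epsilon>\<close> by (intro order_tendstoD) auto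
  then obtain n where "(\<integral>y. (h n y - m)\<^sup>2 \<partial>\<mu>) < \<epsilon>"
    using eventually_happens by fastforce
  with h(1) show ?thesis using that by blast
qed

end

section \<open>Time averages along orbits\<close>

abbreviation unif :: "real \<Rightarrow> real \<Rightarrow> real measure"
  where "unif c d \<equiv> uniform_measure lborel {c..d}"

lemma prob_space_unif: "c < d \<Longrightarrow> prob_space (unif c d)"
  by (intro prob_space_uniform_measure) auto

lemma integral_unif:
  fixes u :: "real \<Rightarrow> real"
  assumes "c < d" and [measurable]: "u \<in> borel_measurable borel"
  shows "(\<integral>t. u t \<partial>unif c d) = (\<integral>t. indicator {c..d} t * u t \<partial>lborel) / (d - c)"
proof -
  have "unif c d = density lborel (\<lambda>t. ennreal (indicator {c..d} t / (d - c)))"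
    unfolding uniform_measure_def using \<open>c < d\<close>
    by (intro density_cong) (auto simp: divide_ennreal[symmetric] ennreal_indicator)
  then have "(\<integral>t. u t \<partial>unif c d) = (\<integral>t. (indicator {c..d} t / (d - c)) *\<^sub>R u t \<partial>lborel)"
    using \<open>c < d\<close> by (simp add: integral_density)
  then show ?thesis by simp
qed

text \<open>The shifted and the original window differ by at most two intervals of length
  \<open>\<bar>s\<bar>\<close>, one at each end, whatever the sign and size of
  \<open>s\<close>.\<close>

lemma integral_unif_shift:
  fixes u :: "real \<Rightarrow> real"
  assumes "0 < T" and [measurable]: "u \<in> borel_measurable borel" and bound: "\<And>t. \<bar>u t\<bar> \<le> C"
  shows "\<bar>(\<integral>t. u (t + s) \<partial>unif 0 T) - (\<integral>t. u t \<partial>unif 0 T)\<bar> \<le> 2 * C * \<bar>s\<bar> / T"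
proof -
  have "0 \<le> C" using bound[of 0] by linarith
  have i: "integrable lborel (\<lambda>t. indicator {c..d} t * u t)" for c d
    using bound by (intro integrableI_bounded_set[where A = "{c..d}" and B = C])
      (auto simp: indicator_def emeasure_lborel_Icc_eq)
  have "(\<integral>t. indicator {0..T} t * u (t + s) \<partial>lborel) = (\<integral>t. indicator {s..T + s} t * u t \<partial>lborel)"
    using lborel_integral_real_affine[of 1 "\<lambda>t. indicator {s..T + s} t * u t" s]
    by (simp add: indicator_def add.commute)
  then have "\<bar>(\<integral>t. indicator {0..T} t * u (t + s) \<partial>lborel) - (\<integral>t. indicator {0..T} t * u t \<partial>lborel)\<bar>
      = \<bar>\<integral>t. indicator {s..T + s} t * u t - indicator {0..T} t * u t \<partial>lborel\<bar>"
    using i by simp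
  also have "\<dots> \<le> (\<integral>t. \<bar>indicator {s..T + s} t * u t - indicator {0..T} t * u t\<bar> \<partial>lborel)"
    by (rule integral_abs_bound)
  also have "\<dots> \<le> (\<integral>t. C * (indicator {min 0 s..max 0 s} t + indicator {T + min 0 s..T + max 0 s} t) \<partial>lborel)"
  proof (rule integral_mono)
    show "\<bar>indicator {s..T + s} t * u t - indicator {0..T} t * u t\<bar>
        \<le> C * (indicator {min 0 s..max 0 s} t + indicator {T + min 0 s..T + max 0 s} t)" for t
      using bound[of t] \<open>0 \<le> C\<close> by (auto simp: indicator_def min_def max_def split: if_splits)
  qed (use i in auto)
  also have "\<dots> = C * (2 * \<bar>s\<bar>)"
    by (subst Bochner_Integration.integral_mult_right_zero, subst Bochner_Integration.integral_add)
      (auto simp: min_def max_def)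
  finally show ?thesis
    using \<open>0 < T\<close> by (simp add: integral_unif diff_divide_distrib[symmetric] divide_right_mono ac_simps)
qed

context ergodic_flow
begin

lemma integrable_orbit:
  fixes f :: "'a \<Rightarrow> real"
  assumes "0 < T" and [measurable]: "f \<in> borel_measurable borel" and "\<And>y. \<bar>f y\<bar> \<le> C"
  shows "integrable (unif 0 T) (\<lambda>t. f (\<phi> t y))"
proof -
  interpret U: prob_space "unif 0 T" using \<open>0 < T\<close> by (rule prob_space_unif)
  show ?thesis
    using assms(3) by (intro U.integrable_const_bound[where B = C]) auto
qed

text \<open>The set \<open>K\<close> of the proof records what averages of translates of
  \<open>f\<close> retain: continuity, the bound, the mean, and time averages within
  \<open>c / T\<close> of those of \<open>f\<close>, where \<open>c\<close> may depend on the
  function but not on the point. Midpoints average these constants; a translate by \<open>s\<close>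
  adds \<open>2 * C * \<bar>s\<bar>\<close>.\<close>

lemma mean_ergodic:
  fixes f :: "'a \<Rightarrow> real"
  assumes f: "continuous_on UNIV f" and C: "\<And>y. \<bar>f y\<bar> \<le> C" and "0 < \<epsilon>"
  obtains h c where "continuous_on UNIV h" "\<And>y. \<bar>h y\<bar> \<le> C"
    "\<And>T y. 0 < T \<Longrightarrow> \<bar>(\<integral>t. h (\<phi> t y) \<partial>unif 0 T) - (\<integral>t. f (\<phi> t y) \<partial>unif 0 T)\<bar> \<le> c / T"
    "(\<integral>y. (h y - (\<integral>y. f y \<partial>\<mu>))\<^sup>2 \<partial>\<mu>) < \<epsilon>"
proof -
  define K where "K = {h. continuous_on UNIV h \<and> (\<forall>y. \<bar>h y\<bar> \<le> C) \<and> (\<integral>y. h y \<partial>\<mu>) = (\<integral>y. f y \<partial>\<mu>) \<and>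
    (\<exists>c. \<forall>T>0. \<forall>y. \<bar>(\<integral>t. h (\<phi> t y) \<partial>unif 0 T) - (\<integral>t. f (\<phi> t y) \<partial>unif 0 T)\<bar> \<le> c / T)}"
  have KI: "h \<in> K" if "continuous_on UNIV h" "\<And>y. \<bar>h y\<bar> \<le> C" "(\<integral>y. h y \<partial>\<mu>) = (\<integral>y. f y \<partial>\<mu>)"
    "\<And>T y. 0 < T \<Longrightarrow> \<bar>(\<integral>t. h (\<phi> t y) \<partial>unif 0 T) - (\<integral>t. f (\<phi> t y) \<partial>unif 0 T)\<bar> \<le> c / T" for h c
    using that unfolding K_def by blast
  have cont: "continuous_on UNIV h" and mean: "(\<integral>y. h y \<partial>\<mu>) = (\<integral>y. f y \<partial>\<mu>)" if "h \<in> K" for h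
    using that unfolding K_def by blast+
  have meas: "h \<in> borel_measurable borel" if "h \<in> K" for h
    using cont[OF that] by (rule borel_measurable_continuous_onI)
  have bnd: "\<bar>h y\<bar> \<le> C" if "h \<in> K" for h y
    using that unfolding K_def by blast
  have int: "integrable \<mu> h" if "h \<in> K" for h
    using bnd[OF that] meas[OF that] by (intro integrable_const_bound[where B = C]) auto
  have orbit: "integrable (unif 0 T) (\<lambda>t. h (\<phi> t y))" if "h \<in> K" "0 < T" for h T y
    using meas[OF that(1)] bnd[OF that(1)] by (rule integrable_orbit[OF that(2)])
  obtain h where "h \<in> K" "(\<integral>y. (h y - (\<integral>y. f y \<partial>\<mu>))\<^sup>2 \<partial>\<mu>) < \<epsilon>"
  proof (rule convex_invariant_near_const[of K C "\<integral>y. f y \<partial>\<mu>" \<epsilon>])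
    show "K \<noteq> {}"
      using KI[of f 0] f C by auto
    show "(\<lambda>y. (h y + k y) / 2) \<in> K" if hk: "h \<in> K" "k \<in> K" for h k
    proof -
      obtain c where c: "\<And>T y. 0 < T \<Longrightarrow>
          \<bar>(\<integral>t. h (\<phi> t y) \<partial>unif 0 T) - (\<integral>t. f (\<phi> t y) \<partial>unif 0 T)\<bar> \<le> c / T"
        using hk(1) unfolding K_def by blast
      obtain d where d: "\<And>T y. 0 < T \<Longrightarrow>
          \<bar>(\<integral>t. k (\<phi> t y) \<partial>unif 0 T) - (\<integral>t. f (\<phi> t y) \<partial>unif 0 T)\<bar> \<le> d / T"
        using hk(2) unfolding K_def by blast
      have "\<bar>(\<integral>t. (h (\<phi> t y) + k (\<phi> t y)) / 2 \<partial>unif 0 T) - (\<integral>t. f (\<phi> t y) \<partial>unif 0 T)\<bar> \<le> (c + d) / 2 / T"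
        if "0 < T" for T y
      proof -
        have "integrable (unif 0 T) (\<lambda>t. h (\<phi> t y))" "integrable (unif 0 T) (\<lambda>t. k (\<phi> t y))"
          using that hk by (auto intro: orbit)
        then have "(\<integral>t. (h (\<phi> t y) + k (\<phi> t y)) / 2 \<partial>unif 0 T) =
            ((\<integral>t. h (\<phi> t y) \<partial>unif 0 T) + (\<integral>t. k (\<phi> t y) \<partial>unif 0 T)) / 2"
          by simp
        moreover have "(c + d) / 2 / T = (c / T + d / T) / 2" by (simp add: add_divide_distrib)
        ultimately show ?thesis using c[OF that, of y] d[OF that, of y] by argo
      qed
      moreover have "\<bar>(h y + k y) / 2\<bar> \<le> C" for y
      proof -
        show ?thesis using bnd[OF hk(1), of y] bnd[OF hk(2), of y] by argo
      qed
      moreover have "(\<integral>y. (h y + k y) / 2 \<partial>\<mu>) = (\<integral>y. f y \<partial>\<mu>)"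
        using int[OF hk(1)] int[OF hk(2)] mean[OF hk(1)] mean[OF hk(2)] by simp
      ultimately show ?thesis
        using hk cont by (intro KI[of _ "(c + d) / 2"] continuous_intros) auto
    qed
    show "(\<lambda>y. h (\<phi> s y)) \<in> K" if h: "h \<in> K" for h s
    proof -
      obtain c where c: "\<And>T y. 0 < T \<Longrightarrow>
          \<bar>(\<integral>t. h (\<phi> t y) \<partial>unif 0 T) - (\<integral>t. f (\<phi> t y) \<partial>unif 0 T)\<bar> \<le> c / T"
        using h unfolding K_def by blast
      have [measurable]: "h \<in> borel_measurable borel" by (rule meas[OF h])
      have "\<bar>(\<integral>t. h (\<phi> s (\<phi> t y)) \<partial>unif 0 T) - (\<integral>t. f (\<phi> t y) \<partial>unif 0 T)\<bar> \<le> (c + 2 * C * \<bar>s\<bar>) / T"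
        if "0 < T" for T y
      proof -
        have "\<bar>(\<integral>t. h (\<phi> (t + s) y) \<partial>unif 0 T) - (\<integral>t. h (\<phi> t y) \<partial>unif 0 T)\<bar> \<le> 2 * C * \<bar>s\<bar> / T"
          using bnd[OF h] by (intro integral_unif_shift[OF that, of "\<lambda>t. h (\<phi> t y)"]) auto
        moreover have "(\<lambda>t. h (\<phi> (t + s) y)) = (\<lambda>t. h (\<phi> s (\<phi> t y)))"
          by (simp add: add.commute flip: flow_add)
        ultimately show ?thesis using c[OF that, of y] by (simp add: add_divide_distrib)
      qed
      moreover have "continuous_on UNIV (\<lambda>y. h (\<phi> s y))"
        by (intro continuous_on_compose2[OF cont[OF h]] continuous_flow_comp continuous_intros) auto
      ultimately show ?thesis
        using bnd[OF h] mean[OF h] integral_flow[OF meas[OF h]]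
        by (intro KI[of _ "c + 2 * C * \<bar>s\<bar>"]) auto
    qed
  qed (use meas bnd mean \<open>0 < \<epsilon>\<close> in blast)+
  then show ?thesis
    using that unfolding K_def by blast
qed

text \<open>\<open>Q\<close> stands for the normalised measure on the angles, \<open>N T\<close> for
  the doubly averaged measure, and \<open>N_integral\<close> for the interchange of the two
  averages. The convexity step takes the linearised form
  \<open>x \<le> x\<^sup>2 / \<epsilon> + \<epsilon> / 4\<close>, which survives both averages by
  linearity.\<close>

lemma averages_tendsto_in_mean:
  fixes p :: "real \<Rightarrow> 'a" and N :: "real \<Rightarrow> 'a measure"
  assumes lc: "locally_compact_space (euclidean :: 'a topology)"
    and Q: "prob_space Q" and Q_sets [measurable_cong]: "sets Q = sets borel"
    and p [measurable]: "p \<in> borel \<rightarrow>\<^sub>M borel"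
    and N: "eventually (\<lambda>T. prob_space (N T) \<and> sets (N T) = sets borel) at_top"
    and N_integral: "\<And>T (u :: 'a \<Rightarrow> real) B. 0 < T \<Longrightarrow> continuous_on UNIV u \<Longrightarrow> (\<And>y. \<bar>u y\<bar> \<le> B) \<Longrightarrow>
      (\<integral>y. u y \<partial>N T) = (\<integral>\<theta>. (\<integral>t. u (\<phi> t (p \<theta>)) \<partial>unif 0 T) \<partial>Q)"
    and lim: "weak_star_limit N \<mu> at_top"
    and f: "test_function f"
  shows "((\<lambda>T. \<integral>\<theta>. \<bar>(\<integral>t. f (\<phi> t (p \<theta>)) \<partial>unif 0 T) - (\<integral>y. f y \<partial>\<mu>)\<bar> \<partial>Q) \<longlongrightarrow> 0) at_top"
proof (rule tendstoI)
  fix \<epsilon> :: real assume "0 < \<epsilon>"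
  interpret Q: prob_space Q by fact
  define m where "m = (\<integral>y. f y \<partial>\<mu>)"
  obtain C where C: "\<And>y. \<bar>f y\<bar> \<le> C" using test_function_bounded[OF f] by metis
  have cf: "continuous_on UNIV f" using f by (rule test_function_continuous)
  \<comment> \<open>The budget: two errors \<open>\<epsilon>\<^sup>2 / 8\<close>, from
    \<open>h\<close> and from the passage to \<open>N T\<close>, give \<open>\<epsilon> / 4\<close>
    after division by \<open>\<epsilon>\<close>; the linearisation costs
    \<open>\<epsilon> / 4\<close> and the term \<open>c / T\<close> costs
    \<open>\<epsilon> / 2\<close>.\<close>
  have "0 < \<epsilon>\<^sup>2 / 8" using \<open>0 < \<epsilon>\<close> by simp
  then obtain h c where h: "continuous_on UNIV h" "\<And>y. \<bar>h y\<bar> \<le> C"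
    "\<And>T y. 0 < T \<Longrightarrow> \<bar>(\<integral>t. h (\<phi> t y) \<partial>unif 0 T) - (\<integral>t. f (\<phi> t y) \<partial>unif 0 T)\<bar> \<le> c / T"
    "(\<integral>y. (h y - m)\<^sup>2 \<partial>\<mu>) < \<epsilon>\<^sup>2 / 8"
    using mean_ergodic[OF cf C] unfolding m_def by metis
  have [measurable]: "h \<in> borel_measurable borel" "f \<in> borel_measurable borel"
    using h(1) cf by (auto intro: borel_measurable_continuous_onI)
  define u where "u y = (h y - m)\<^sup>2" for y
  have cu: "continuous_on UNIV u"
    unfolding u_def by (intro continuous_intros h)
  have [measurable]: "u \<in> borel_measurable borel"
    using cu by (rule borel_measurable_continuous_onI)
  have u_bound: "u y \<le> (C + \<bar>m\<bar>)\<^sup>2" for y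
  proof -
    have "\<bar>h y - m\<bar> \<le> \<bar>C + \<bar>m\<bar>\<bar>" using h(2)[of y] by linarith
    then show ?thesis by (simp add: abs_le_square_iff u_def)
  qed
  have u0: "0 \<le> u y" for y by (simp add: u_def)
  have "\<forall>\<^sub>F T in at_top. (\<integral>y. u y \<partial>N T) < (\<integral>y. u y \<partial>\<mu>) + \<epsilon>\<^sup>2 / 8"
    using \<open>0 < \<epsilon>\<^sup>2 / 8\<close>
    by (intro weak_star_limit_upper_bound[OF lc prob_space_axioms sets_\<mu> N lim cu u0 u_bound])
  moreover have "((\<lambda>T. c / T) \<longlongrightarrow> 0) at_top"
    by (intro tendsto_divide_0[OF tendsto_const] filterlim_at_top_imp_at_infinity filterlim_ident)
  then have "\<forall>\<^sub>F T in at_top. c / T < \<epsilon> / 2"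
    using \<open>0 < \<epsilon>\<close> by (intro order_tendstoD(2)) auto
  moreover have "\<forall>\<^sub>F T in at_top. 0 < (T :: real)"
    by (rule eventually_gt_at_top)
  ultimately show "\<forall>\<^sub>F T in at_top. dist (\<integral>\<theta>. \<bar>(\<integral>t. f (\<phi> t (p \<theta>)) \<partial>unif 0 T) - (\<integral>y. f y \<partial>\<mu>)\<bar> \<partial>Q) 0 < \<epsilon>"
  proof eventually_elim
    case (elim T)
    interpret U: prob_space "unif 0 T" using elim by (intro prob_space_unif)
    have iu: "integrable (unif 0 T) (\<lambda>t. u (\<phi> t y))" for y
      using elim u0 u_bound by (intro integrable_orbit[where C = "(C + \<bar>m\<bar>)\<^sup>2"]) auto
    have ih: "integrable (unif 0 T) (\<lambda>t. h (\<phi> t y))" for y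
      using elim h by (intro integrable_orbit[where C = C]) auto
    have if': "integrable (unif 0 T) (\<lambda>t. f (\<phi> t y))" for y
      using elim C by (intro integrable_orbit[where C = C]) auto
    have pt: "\<bar>(\<integral>t. f (\<phi> t y) \<partial>unif 0 T) - m\<bar> \<le> (\<integral>t. u (\<phi> t y) \<partial>unif 0 T) / \<epsilon> + (c / T + \<epsilon> / 4)" for y
    proof -
      have "\<bar>(\<integral>t. h (\<phi> t y) \<partial>unif 0 T) - m\<bar> = \<bar>\<integral>t. h (\<phi> t y) - m \<partial>unif 0 T\<bar>"
        using ih U.prob_space by simp
      also have "\<dots> \<le> (\<integral>t. \<bar>h (\<phi> t y) - m\<bar> \<partial>unif 0 T)"
        by (rule integral_abs_bound)
      also have "\<dots> \<le> (\<integral>t. u (\<phi> t y) / \<epsilon> + \<epsilon> / 4 \<partial>unif 0 T)"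
      proof (rule integral_mono)
        fix t
        have "0 \<le> (\<bar>h (\<phi> t y) - m\<bar> - \<epsilon> / 2)\<^sup>2 / \<epsilon>" using \<open>0 < \<epsilon>\<close> by simp
        also have "\<dots> = u (\<phi> t y) / \<epsilon> + \<epsilon> / 4 - \<bar>h (\<phi> t y) - m\<bar>"
          using \<open>0 < \<epsilon>\<close> by (simp add: u_def power2_diff field_simps) (simp add: power2_eq_square)
        finally show "\<bar>h (\<phi> t y) - m\<bar> \<le> u (\<phi> t y) / \<epsilon> + \<epsilon> / 4" by simp
      qed (use ih iu in auto)
      also have "\<dots> = (\<integral>t. u (\<phi> t y) \<partial>unif 0 T) / \<epsilon> + \<epsilon> / 4"
        using iu U.prob_space by simp
      finally show ?thesis using h(3)[of T y] elim by linarith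
    qed
    have "\<bar>\<integral>t. u (\<phi> t y) \<partial>unif 0 T\<bar> \<le> (C + \<bar>m\<bar>)\<^sup>2" for y
    proof -
      have "(\<integral>t. u (\<phi> t y) \<partial>unif 0 T) \<le> (C + \<bar>m\<bar>)\<^sup>2"
        using iu u_bound by (intro U.integral_le_const) auto
      moreover have "0 \<le> (\<integral>t. u (\<phi> t y) \<partial>unif 0 T)" using u0 by (intro integral_nonneg_AE) auto
      ultimately show ?thesis by simp
    qed
    then have iQ: "integrable Q (\<lambda>\<theta>. \<integral>t. u (\<phi> t (p \<theta>)) \<partial>unif 0 T)"
      by (intro Q.integrable_const_bound[where B = "(C + \<bar>m\<bar>)\<^sup>2"]) auto
    have "(\<integral>\<theta>. \<bar>(\<integral>t. f (\<phi> t (p \<theta>)) \<partial>unif 0 T) - m\<bar> \<partial>Q)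
        \<le> (\<integral>\<theta>. (\<integral>t. u (\<phi> t (p \<theta>)) \<partial>unif 0 T) / \<epsilon> + (c / T + \<epsilon> / 4) \<partial>Q)"
    proof (rule integral_mono')
      show "integrable Q (\<lambda>\<theta>. (\<integral>t. u (\<phi> t (p \<theta>)) \<partial>unif 0 T) / \<epsilon> + (c / T + \<epsilon> / 4))"
        using iQ by auto
    qed (use pt in \<open>auto intro: order_trans[OF abs_ge_zero]\<close>)
    also have "\<dots> = (\<integral>y. u y \<partial>N T) / \<epsilon> + (c / T + \<epsilon> / 4)"
      using iQ Q.prob_space N_integral[of T u "(C + \<bar>m\<bar>)\<^sup>2"] elim cu u0 u_bound by simp
    also have "\<dots> < (\<epsilon>\<^sup>2 / 4) / \<epsilon> + (\<epsilon> / 2 + \<epsilon> / 4)"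
    proof -
      have "(\<integral>y. u y \<partial>N T) < \<epsilon>\<^sup>2 / 4" using elim h(4) by (simp add: u_def)
      then have "(\<integral>y. u y \<partial>N T) / \<epsilon> < (\<epsilon>\<^sup>2 / 4) / \<epsilon>" using \<open>0 < \<epsilon>\<close> by (rule divide_strict_right_mono)
      then show ?thesis using elim by linarith
    qed
    also have "\<dots> = \<epsilon>" using \<open>0 < \<epsilon>\<close> by (simp add: power2_eq_square)
    finally show ?case by (simp add: m_def)
  qed
qed

end

section \<open>Exceptional sets of zero lower density\<close>

lemma cesaro_zero:
  fixes q :: "real \<Rightarrow> real"
  assumes [measurable]: "q \<in> borel_measurable borel"
    and bound: "\<And>t. 0 \<le> q t" "\<And>t. q t \<le> 1" and lim: "(q \<longlongrightarrow> 0) at_top"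
  shows "((\<lambda>S. \<integral>t. q t \<partial>unif 0 S) \<longlongrightarrow> 0) at_top"
proof (rule tendstoI)
  fix \<epsilon> :: real assume "0 < \<epsilon>"
  then have "\<forall>\<^sub>F t in at_top. q t < \<epsilon> / 2"
    using order_tendstoD(2)[OF lim, of "\<epsilon> / 2"] by simp
  then obtain R0 where R0: "\<And>t. R0 \<le> t \<Longrightarrow> q t < \<epsilon> / 2"
    by (auto simp: eventually_at_top_linorder)
  define R where "R = max 1 R0"
  have R: "1 \<le> R" "\<And>t. R \<le> t \<Longrightarrow> q t < \<epsilon> / 2" using R0 by (auto simp: R_def)
  have "((\<lambda>S. R / S) \<longlongrightarrow> 0) at_top"
    by (intro tendsto_divide_0[OF tendsto_const] filterlim_at_top_imp_at_infinity filterlim_ident)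
  then have "\<forall>\<^sub>F S in at_top. R / S < \<epsilon> / 2"
    using \<open>0 < \<epsilon>\<close> by (intro order_tendstoD(2)) auto
  moreover have "\<forall>\<^sub>F S in at_top. R < S" by (rule eventually_gt_at_top)
  ultimately show "\<forall>\<^sub>F S in at_top. dist (\<integral>t. q t \<partial>unif 0 S) 0 < \<epsilon>"
  proof eventually_elim
    case (elim S)
    then have "0 < S" using R by linarith
    interpret U: prob_space "unif 0 S" using \<open>0 < S\<close> by (rule prob_space_unif)
    have iq: "integrable (unif 0 S) q"
      using bound by (intro U.integrable_const_bound[where B = 1]) auto
    \<comment> \<open>Up to \<open>R\<close> the trivial bound 1 is used; that initial stretch has
      relative length \<open>R / S\<close>.\<close>
    have "(\<integral>t. q t \<partial>unif 0 S) \<le> (\<integral>t. \<epsilon> / 2 + indicator {0..R} t \<partial>unif 0 S)"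
    proof (rule integral_mono_AE)
      have "AE t in unif 0 S. t \<in> {0..S}"
        by (intro AE_uniform_measureI) auto
      then show "AE t in unif 0 S. q t \<le> \<epsilon> / 2 + indicator {0..R} t"
      proof eventually_elim
        case (elim t)
        then show ?case
          using bound(2)[of t] R(2)[of t] \<open>0 < \<epsilon>\<close> by (auto simp: indicator_def)
      qed
      show "integrable (unif 0 S) (\<lambda>t. \<epsilon> / 2 + indicator {0..R} t)"
        by (intro U.integrable_const_bound[where B = "\<epsilon> / 2 + 1"])
          (use \<open>0 < \<epsilon>\<close> in \<open>auto simp: indicator_def\<close>)
    qed (use iq in auto)
    also have "\<dots> = \<epsilon> / 2 + measure (unif 0 S) {0..R}"
      by (subst Bochner_Integration.integral_add) (use U.prob_space in \<open>auto simp: U.emeasure_eq_measure\<close>)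
    also have "measure (unif 0 S) {0..R} = R / S"
      using elim R \<open>0 < S\<close> by (subst measure_uniform_measure) (auto simp: min_absorb2 Int_absorb1)
    finally have "(\<integral>t. q t \<partial>unif 0 S) < \<epsilon>" using elim by linarith
    moreover have "0 \<le> (\<integral>t. q t \<partial>unif 0 S)" using bound by (intro integral_nonneg_AE) auto
    ultimately show ?case by simp
  qed
qed

text \<open>A lower limit is bounded above along any sequence tending to infinity, so control at the
  times \<open>S n\<close> suffices.\<close>

lemma zero_lower_densityI:
  fixes S v :: "nat \<Rightarrow> real"
  assumes Z: "Z \<in> sets lebesgue" and S: "filterlim S at_top sequentially" and v: "v \<longlonglongrightarrow> 0"
    and le: "\<And>n. measure lebesgue (Z \<inter> {0..S n}) / S n \<le> v n"
  shows "zero_lower_density Z"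
  unfolding zero_lower_density_def
proof (intro conjI Z antisym)
  let ?r = "\<lambda>T. ereal (measure lebesgue (Z \<inter> {0..T}) / T)"
  show "0 \<le> Liminf at_top ?r"
    by (intro Liminf_bounded eventually_mono[OF eventually_gt_at_top[of 0]]) auto
  show "Liminf at_top ?r \<le> 0"
  proof (rule ccontr)
    assume "\<not> Liminf at_top ?r \<le> 0"
    then have "0 < Liminf at_top ?r" by (simp add: not_le)
    from ereal_dense2[OF this] obtain y where y: "0 < ereal y" "ereal y < Liminf at_top ?r"
      by blast
    then have "\<forall>\<^sub>F T in at_top. ereal y < ?r T"
      by (intro less_LiminfD)
    then have "\<forall>\<^sub>F n in sequentially. ereal y < ?r (S n)"
      using S by (rule eventually_compose_filterlim)
    moreover have "\<forall>\<^sub>F n in sequentially. v n < y"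
      using y v by (intro order_tendstoD(2)) auto
    ultimately have "\<forall>\<^sub>F n in sequentially. False"
    proof eventually_elim
      case (elim n)
      then show False using le[of n] by simp
    qed
    then show False by simp
  qed
qed

text \<open>
  Convergence in mean makes the bad times for most \<open>\<theta>\<close> a small fraction of \<open>[0, S]\<close> when \<open>S\<close> is
  large. Along a sequence \<open>S\<^sub>n\<close> growing so fast that \<open>[0, S\<^sub>n]\<close> is negligible inside
  \<open>[0, S\<^sub>n\<^sub>+\<^sub>1]\<close>, the bad times of the successive blocks can be collected into one set.
\<close>

lemma AE_convergence_off_zero_lower_density:
  fixes d :: "nat \<Rightarrow> real \<Rightarrow> real \<Rightarrow> real"
  assumes Q: "prob_space Q" and Q_sets [measurable_cong]: "sets Q = sets borel"
    and d [measurable]: "\<And>k. (\<lambda>(T, \<theta>). d k T \<theta>) \<in> borel_measurable (borel \<Otimes>\<^sub>M borel)"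
    and nonneg: "\<And>k T \<theta>. 0 \<le> d k T \<theta>"
    and int: "\<And>k T. integrable Q (d k T)"
    and lim: "\<And>k. ((\<lambda>T. \<integral>\<theta>. d k T \<theta> \<partial>Q) \<longlongrightarrow> 0) at_top"
  shows "AE \<theta> in Q. \<exists>Z. zero_lower_density Z \<and>
    (\<forall>k. ((\<lambda>T. d k T \<theta>) \<longlongrightarrow> 0) (inf at_top (principal (- Z))))"
proof -
  interpret Q: prob_space Q by fact
  have Q_space [simp]: "space Q = UNIV" using sets_eq_imp_space_eq[OF Q_sets] by simp
  \<comment> \<open>Level \<open>n\<close> tests the first \<open>n + 1\<close> functions with
    tolerance \<open>1 / (n + 1)\<close>, so passing ever higher levels controls each of
    them.\<close>
  define B where "B n T \<theta> \<longleftrightarrow> (\<exists>k\<le>n. 1 / (real n + 1) < d k T \<theta>)" for n T \<theta>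
  define b :: "nat \<Rightarrow> real \<Rightarrow> real \<Rightarrow> real" where "b n T \<theta> = of_bool (B n T \<theta>)" for n T \<theta>
  have B_meas [measurable]: "Measurable.pred (borel \<Otimes>\<^sub>M borel) (\<lambda>(T, \<theta>). B n T \<theta>)" for n
    unfolding B_def by measurable
  have b_meas [measurable]: "(\<lambda>(T, \<theta>). b n T \<theta>) \<in> borel_measurable (borel \<Otimes>\<^sub>M borel)" for n
    unfolding b_def by measurable
  have b01: "0 \<le> b n T \<theta>" "b n T \<theta> \<le> 1" for n T \<theta> by (auto simp: b_def)
  have ib: "integrable Q (b n T)" for n T
    using b01 by (intro Q.integrable_const_bound[where B = 1]) auto
  define q where "q n T = (\<integral>\<theta>. b n T \<theta> \<partial>Q)" for n T
  have q_meas [measurable]: "q n \<in> borel_measurable borel" for n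
    unfolding q_def by measurable
  have q01: "0 \<le> q n T" "q n T \<le> 1" for n T
    using b01 ib by (auto simp: q_def intro!: integral_nonneg_AE Q.integral_le_const)
  \<comment> \<open>Union bound and Markov's inequality over the finitely many functions tested at
    level \<open>n\<close>.\<close>
  have q_lim: "(q n \<longlongrightarrow> 0) at_top" for n
  proof (rule tendsto_sandwich)
    show "\<forall>\<^sub>F T in at_top. 0 \<le> q n T" using q01 by simp
    show "\<forall>\<^sub>F T in at_top. q n T \<le> (\<Sum>k\<le>n. (real n + 1) * (\<integral>\<theta>. d k T \<theta> \<partial>Q))"
    proof (rule always_eventually, rule allI)
      fix T
      have "q n T \<le> (\<integral>\<theta>. (\<Sum>k\<le>n. (real n + 1) * d k T \<theta>) \<partial>Q)"
        unfolding q_def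
      proof (rule integral_mono)
        fix \<theta>
        show "b n T \<theta> \<le> (\<Sum>k\<le>n. (real n + 1) * d k T \<theta>)"
        proof (cases "B n T \<theta>")
          case True
          then obtain k where k: "k \<le> n" "1 / (real n + 1) < d k T \<theta>" by (auto simp: B_def)
          have "b n T \<theta> \<le> (real n + 1) * d k T \<theta>"
            using k True by (simp add: b_def field_simps)
          also have "\<dots> \<le> (\<Sum>k\<le>n. (real n + 1) * d k T \<theta>)"
            using k nonneg by (intro member_le_sum) auto
          finally show ?thesis .
        qed (use nonneg in \<open>auto simp: b_def intro!: sum_nonneg\<close>)
      qed (use int ib in auto)
      also have "\<dots> = (\<Sum>k\<le>n. (real n + 1) * (\<integral>\<theta>. d k T \<theta> \<partial>Q))"
        using int by (subst Bochner_Integration.integral_sum) auto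
      finally show "q n T \<le> (\<Sum>k\<le>n. (real n + 1) * (\<integral>\<theta>. d k T \<theta> \<partial>Q))" .
    qed
    have "((\<lambda>T. \<Sum>k\<le>n. (real n + 1) * (\<integral>\<theta>. d k T \<theta> \<partial>Q)) \<longlongrightarrow> (\<Sum>k\<le>n. (real n + 1) * 0)) at_top"
      by (intro tendsto_intros lim)
    then show "((\<lambda>T. \<Sum>k\<le>n. (real n + 1) * (\<integral>\<theta>. d k T \<theta> \<partial>Q)) \<longlongrightarrow> 0) at_top" by simp
  qed simp
  \<comment> \<open>The bounds \<open>(1 / 2) ^ n\<close> are summable, which after Fubini gives
    almost sure convergence in the manner of Borel--Cantelli; \<open>1 \<le> s\<close> keeps the
    interval nondegenerate.\<close>
  define good where "good n s \<longleftrightarrow> 1 \<le> s \<and> (\<integral>T. q n T \<partial>unif 0 s) \<le> (1 / 2) ^ n" for n s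
  have ex: "\<exists>s\<ge>r. good n s" for n r
  proof -
    have "\<forall>\<^sub>F s in at_top. (\<integral>T. q n T \<partial>unif 0 s) < (1 / 2) ^ n"
      using cesaro_zero[OF q_meas q01 q_lim, of n] by (rule order_tendstoD(2)) simp
    moreover have "\<forall>\<^sub>F s in at_top. max 1 r \<le> s" by (rule eventually_ge_at_top)
    ultimately have "\<forall>\<^sub>F s in at_top. r \<le> s \<and> good n s"
      by eventually_elim (auto simp: good_def)
    then show ?thesis using eventually_happens by fastforce
  qed
  \<comment> \<open>The factor \<open>n + 2\<close> yields
    \<open>S n / S (Suc n) \<le> 1 / (n + 2)\<close>, so earlier blocks drop out of the
    density.\<close>
  obtain S where S: "\<And>n. good n (S n)" "\<And>n. (real n + 2) * S n \<le> S (Suc n)"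
    using dependent_nat_choice[of good "\<lambda>n s s'. (real n + 2) * s \<le> s'"] ex by (metis (full_types))
  have S1: "1 \<le> S n" for n using S(1) by (simp add: good_def)
  have S_step: "S n + 1 \<le> S (Suc n)" for n
  proof -
    have "2 * S n \<le> (real n + 2) * S n" using S1[of n] by (intro mult_right_mono) auto
    then show ?thesis using S(2)[of n] S1[of n] by linarith
  qed
  have S_mono: "S m \<le> S n" if "m \<le> n" for m n
  proof (rule lift_Suc_mono_le[OF _ that])
    show "S n \<le> S (Suc n)" for n using S_step[of n] by linarith
  qed
  have S_ge: "real n \<le> S n" for n
  proof (induction n)
    case 0
    then show ?case using S1[of 0] by simp
  next
    case (Suc n)
    then show ?case using S_step[of n] by simp
  qed
  have S_top: "filterlim S at_top sequentially"
    by (rule filterlim_at_top_mono[OF filterlim_real_sequentially]) (simp add: S_ge)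
  define u where "u n \<theta> = (\<integral>T. b n T \<theta> \<partial>unif 0 (S n))" for n \<theta>
  have u_meas [measurable]: "u n \<in> borel_measurable borel" for n
  proof -
    interpret U: prob_space "unif 0 (S n)" using S1[of n] by (intro prob_space_unif) simp
    show ?thesis unfolding u_def by measurable
  qed
  have u01: "0 \<le> u n \<theta>" "u n \<theta> \<le> 1" for n \<theta>
  proof -
    interpret U: prob_space "unif 0 (S n)" using S1[of n] by (intro prob_space_unif) simp
    have "integrable (unif 0 (S n)) (\<lambda>T. b n T \<theta>)"
      using b01 by (intro U.integrable_const_bound[where B = 1]) auto
    then show "0 \<le> u n \<theta>" "u n \<theta> \<le> 1"
      using b01 by (auto simp: u_def intro!: integral_nonneg_AE U.integral_le_const)
  qed
  have u_int: "(\<integral>\<theta>. u n \<theta> \<partial>Q) \<le> (1 / 2) ^ n" for n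
  proof -
    interpret U: prob_space "unif 0 (S n)" using S1[of n] by (intro prob_space_unif) simp
    interpret UQ: pair_prob_space "unif 0 (S n)" Q ..
    have "integrable (unif 0 (S n) \<Otimes>\<^sub>M Q) (\<lambda>(T, \<theta>). b n T \<theta>)"
      using b01 by (intro UQ.P.integrable_const_bound[where B = 1]) auto
    then have "(\<integral>\<theta>. u n \<theta> \<partial>Q) = (\<integral>T. q n T \<partial>unif 0 (S n))"
      unfolding u_def q_def by (rule UQ.Fubini_integral)
    then show ?thesis using S(1)[of n] by (simp add: good_def)
  qed
  have "AE \<theta> in Q. summable (\<lambda>n. u n \<theta>)"
  proof (rule AE_summable_integrable)
    show "integrable Q (u n)" for n
      using u01 by (intro Q.integrable_const_bound[where B = 1]) auto
    show "summable (\<lambda>n. \<integral>\<theta>. u n \<theta> \<partial>Q)"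
    proof (rule summable_comparison_test)
      show "\<exists>N. \<forall>n\<ge>N. norm (\<integral>\<theta>. u n \<theta> \<partial>Q) \<le> (1 / 2) ^ n"
        using u_int u01 by (auto simp: integral_nonneg_AE)
    qed (intro summable_geometric, simp)
  qed (rule u01)
  then show ?thesis
  proof eventually_elim
    case (elim \<theta>)
    then have u0: "(\<lambda>n. u n \<theta>) \<longlonglongrightarrow> 0" by (rule summable_LIMSEQ_zero)
    \<comment> \<open>The block ending at \<open>S (Suc n)\<close> is tested at level
      \<open>Suc n\<close>, the level at which \<open>u (Suc n) \<theta>\<close> measures the bad
      fraction of all of \<open>[0, S (Suc n)]\<close>.\<close>
    define Z where "Z = (\<Union>n. {T. S n < T \<and> T \<le> S (Suc n) \<and> B (Suc n) T \<theta>})"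
    have B_sets [measurable]: "{T. B n T \<theta>} \<in> sets borel" for n
    proof -
      have "{T \<in> space borel. B n T \<theta>} \<in> sets borel" by measurable
      then show ?thesis by simp
    qed
    have "Z \<in> sets borel"
    proof -
      have "{T. S n < T \<and> T \<le> S (Suc n) \<and> B (Suc n) T \<theta>} = {S n<..S (Suc n)} \<inter> {T. B (Suc n) T \<theta>}" for n
        by auto
      then show ?thesis unfolding Z_def by simp
    qed
    then have Z: "Z \<in> sets lebesgue" by simp
    have "zero_lower_density Z"
    proof (rule zero_lower_densityI[OF Z])
      show "filterlim (\<lambda>n. S (Suc n)) at_top sequentially"
        using S_top by (rule filterlim_compose) (rule filterlim_Suc)
      have "(\<lambda>n. 1 / (real n + 2) + u (Suc n) \<theta>) \<longlonglongrightarrow> 0 + 0"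
      proof (rule tendsto_add)
        have "(\<lambda>n. 1 / real (n + 2)) \<longlonglongrightarrow> 0"
          using LIMSEQ_ignore_initial_segment[OF lim_1_over_n, of 2] .
        then show "(\<lambda>n. 1 / (real n + 2)) \<longlonglongrightarrow> 0" by (simp add: add.commute)
        show "(\<lambda>n. u (Suc n) \<theta>) \<longlonglongrightarrow> 0" using u0 by (rule LIMSEQ_Suc)
      qed
      then show "(\<lambda>n. 1 / (real n + 2) + u (Suc n) \<theta>) \<longlonglongrightarrow> 0" by simp
      show "measure lebesgue (Z \<inter> {0..S (Suc n)}) / S (Suc n) \<le> 1 / (real n + 2) + u (Suc n) \<theta>" for n
      proof -
        let ?E = "{0..S (Suc n)} \<inter> {T. B (Suc n) T \<theta>}"
        \<comment> \<open>Earlier blocks are swallowed by \<open>[0, S n]\<close>, the current one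
          lies in \<open>?E\<close>, and later ones start beyond the interval.\<close>
        have "Z \<inter> {0..S (Suc n)} \<subseteq> {0..S n} \<union> ?E"
        proof
          fix T assume T: "T \<in> Z \<inter> {0..S (Suc n)}"
          then obtain m where m: "S m < T" "T \<le> S (Suc m)" "B (Suc m) T \<theta>" by (auto simp: Z_def)
          consider "Suc m \<le> n" | "m = n" | "Suc n \<le> m" by linarith
          then show "T \<in> {0..S n} \<union> ?E"
          proof cases
            case 1
            then show ?thesis using S_mono[OF 1] m T by auto
          next
            case 2
            then show ?thesis using m T by auto
          next
            case 3
            then show ?thesis using S_mono[OF 3] m T by auto
          qed
        qed
        then have "measure lebesgue (Z \<inter> {0..S (Suc n)}) \<le> measure lebesgue ({0..S n} \<union> ?E)"
          using Z by (intro measure_mono_fmeasurable fmeasurable.Un fmeasurable_Int_fmeasurable)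
            (auto intro: sets.Int)
        also have "\<dots> \<le> measure lebesgue {0..S n} + measure lebesgue ?E"
          by (intro measure_Un_le) auto
        also have "measure lebesgue ?E = measure lborel ?E"
          by (intro measure_completion) auto
        also have "measure lborel ?E = S (Suc n) * u (Suc n) \<theta>"
        proof -
          have "u (Suc n) \<theta> = (\<integral>T. indicator {T. B (Suc n) T \<theta>} T \<partial>unif 0 (S (Suc n)))"
            unfolding u_def b_def by (intro Bochner_Integration.integral_cong) (auto simp: indicator_def)
          also have "\<dots> = measure (unif 0 (S (Suc n))) {T. B (Suc n) T \<theta>}"
            by simp
          also have "\<dots> = measure lborel ?E / S (Suc n)"
            using S1[of "Suc n"] by (subst measure_uniform_measure) auto
          finally show ?thesis using S1[of "Suc n"] by simp
        qed
        finally have "measure lebesgue (Z \<inter> {0..S (Suc n)}) \<le> S n + S (Suc n) * u (Suc n) \<theta>"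
          using S1[of n] by simp
        then have "measure lebesgue (Z \<inter> {0..S (Suc n)}) / S (Suc n) \<le> S n / S (Suc n) + u (Suc n) \<theta>"
          using S1[of "Suc n"] by (simp add: field_simps)
        moreover have "S n / S (Suc n) \<le> 1 / (real n + 2)"
          using S(2)[of n] S1[of "Suc n"] by (simp add: field_simps)
        ultimately show ?thesis by linarith
      qed
    qed
    moreover have "((\<lambda>T. d k T \<theta>) \<longlongrightarrow> 0) (inf at_top (principal (- Z)))" for k
    proof (rule tendstoI)
      fix \<epsilon> :: real assume "0 < \<epsilon>"
      obtain n0 where n0: "1 / (real n0 + 1) < \<epsilon>"
        using reals_Archimedean[OF \<open>0 < \<epsilon>\<close>] by (auto simp: inverse_eq_divide add.commute)
      define n where "n = max n0 k"
      have "1 / (real n + 1) \<le> 1 / (real n0 + 1)"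
        by (intro divide_left_mono) (auto simp: n_def)
      then have n: "1 / (real n + 1) < \<epsilon>" "k \<le> n" using n0 by (auto simp: n_def)
      have "d k T \<theta> < \<epsilon>" if T: "S n < T" "T \<notin> Z" for T
      proof -
        \<comment> \<open>\<open>S j\<close> is the first endpoint not before \<open>T\<close>.
          Since \<open>T\<close> lies beyond \<open>S n\<close>, the index \<open>j\<close> is a
          successor larger than \<open>n\<close>, and \<open>T\<close> belongs to the block tested
          at level \<open>j\<close>.\<close>
        obtain j where j: "T \<le> S j" "\<And>i. i < j \<Longrightarrow> S i < T"
        proof -
          have "\<exists>j. T \<le> S j" using S_ge real_arch_simple[of T] by (meson order_trans)
          then show ?thesis
            using that[of "LEAST j. T \<le> S j"] LeastI_ex[of "\<lambda>j. T \<le> S j"] not_less_Least[of _ "\<lambda>j. T \<le> S j"]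
            by (meson not_le)
        qed
        have "n < j" using T j S_mono[of j n] by (meson not_le order_trans leD)
        then obtain m where m: "j = Suc m" "n \<le> m" by (cases j) auto
        have "\<not> B (Suc m) T \<theta>"
          using j(1) j(2)[of m] m T(2) by (auto simp: Z_def)
        then have "d k T \<theta> \<le> 1 / (real (Suc m) + 1)"
          using n(2) m by (auto simp: B_def not_less)
        also have "\<dots> \<le> 1 / (real n + 1)" using m by (intro divide_left_mono) auto
        finally show ?thesis using n by linarith
      qed
      then have "\<forall>\<^sub>F T in at_top. T \<in> - Z \<longrightarrow> dist (d k T \<theta>) 0 < \<epsilon>"
        using nonneg by (intro eventually_mono[OF eventually_gt_at_top[of "S n"]]) auto
      then show "\<forall>\<^sub>F T in inf at_top (principal (- Z)). dist (d k T \<theta>) 0 < \<epsilon>"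
        by (simp add: eventually_inf_principal)
    qed
    ultimately show ?case by blast
  qed
qed

section \<open>Orbits of the diagonal flow\<close>

context ergodic_flow
begin

text \<open>The construction of the exceptional set is applied to all nonempty words at once; a
  \<open>Z\<close> that serves every word serves every test function.\<close>

lemma AE_orbit_averages_converge:
  fixes p :: "real \<Rightarrow> 'a"
  assumes lc: "locally_compact_space (euclidean :: 'a topology)" and "a < b"
    and p [measurable]: "p \<in> borel \<rightarrow>\<^sub>M borel"
    and lim: "weak_star_limit
      (\<lambda>T. bind (unif 0 T) (\<lambda>t. distr (unif a b) borel (\<lambda>\<theta>. \<phi> t (p \<theta>)))) \<mu> at_top"
  shows "AE \<theta> in unif a b. \<exists>Z. zero_lower_density Z \<and>
    weak_star_limit (\<lambda>T. distr (unif 0 T) borel (\<lambda>t. \<phi> t (p \<theta>))) \<mu> (inf at_top (principal (- Z)))"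
proof -
  define N where "N T = bind (unif 0 T) (\<lambda>t. distr (unif a b) borel (\<lambda>\<theta>. \<phi> t (p \<theta>)))" for T
  interpret Q: prob_space "unif a b" using \<open>a < b\<close> by (rule prob_space_unif)
  have kernel: "(\<lambda>t. distr (unif a b) borel (\<lambda>\<theta>. \<phi> t (p \<theta>))) \<in> unif 0 T \<rightarrow>\<^sub>M subprob_algebra borel" for T
  proof (rule measurable_distr2[where M = "unif a b"])
    show "(\<lambda>t. unif a b) \<in> unif 0 T \<rightarrow>\<^sub>M subprob_algebra (unif a b)"
      by (intro measurable_const) (simp add: space_subprob_algebra Q.subprob_space_axioms)
  qed measurable
  have prob_inner: "prob_space (distr (unif a b) borel (\<lambda>\<theta>. \<phi> t (p \<theta>)))" for t
    by (intro Q.prob_space_distr) measurable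
  have N_prob: "prob_space (N T)" "sets (N T) = sets borel" if "0 < T" for T
  proof -
    interpret U: prob_space "unif 0 T" using that by (rule prob_space_unif)
    show "prob_space (N T)"
      unfolding N_def by (intro U.prob_space_bind[OF _ kernel]) (simp add: prob_inner)
    show "sets (N T) = sets borel"
      unfolding N_def by (intro sets_bind) auto
  qed
  have N_integral: "(\<integral>y. u y \<partial>N T) = (\<integral>\<theta>. (\<integral>t. u (\<phi> t (p \<theta>)) \<partial>unif 0 T) \<partial>unif a b)"
    if "0 < T" and u: "continuous_on UNIV u" and B: "\<And>y. \<bar>u y\<bar> \<le> B" for T B and u :: "'a \<Rightarrow> real"
  proof -
    interpret U: prob_space "unif 0 T" using that(1) by (rule prob_space_unif)
    interpret UQ: pair_prob_space "unif 0 T" "unif a b" ..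
    have [measurable]: "u \<in> borel_measurable borel" using u by (rule borel_measurable_continuous_onI)
    have "(\<integral>y. u y \<partial>N T) = (\<integral>t. (\<integral>y. u y \<partial>distr (unif a b) borel (\<lambda>\<theta>. \<phi> t (p \<theta>))) \<partial>unif 0 T)"
      unfolding N_def
    proof (rule integral_bind[OF _ _ kernel])
      show "AE t in unif 0 T. emeasure (distr (unif a b) borel (\<lambda>\<theta>. \<phi> t (p \<theta>)))
          (space (distr (unif a b) borel (\<lambda>\<theta>. \<phi> t (p \<theta>)))) \<le> ennreal 1"
        using prob_space.emeasure_space_1[OF prob_inner] by (intro AE_I2) simp
    qed (use B U.finite_measure_axioms in auto)
    also have "\<dots> = (\<integral>t. (\<integral>\<theta>. u (\<phi> t (p \<theta>)) \<partial>unif a b) \<partial>unif 0 T)"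
      by (intro Bochner_Integration.integral_cong refl integral_distr) measurable
    also have "\<dots> = (\<integral>\<theta>. (\<integral>t. u (\<phi> t (p \<theta>)) \<partial>unif 0 T) \<partial>unif a b)"
    proof (rule UQ.Fubini_integral[symmetric])
      show "integrable (unif 0 T \<Otimes>\<^sub>M unif a b) (\<lambda>(t, \<theta>). u (\<phi> t (p \<theta>)))"
        using B by (intro UQ.P.integrable_const_bound[where B = B]) auto
    qed
    finally show ?thesis .
  qed
  obtain e :: "nat \<Rightarrow> 'a \<Rightarrow> real" where e: "\<And>n. test_function (e n)" "\<And>x. \<exists>n. e n x \<noteq> 0"
    "\<And>x y. x \<noteq> y \<Longrightarrow> \<exists>n. e n x \<noteq> e n y"
    using countable_test_functions[OF lc] by metis
  define f where "f k = word e (from_nat_into {ws. ws \<noteq> []} k)" for k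
  have f: "test_function (f k)" for k
  proof -
    have "from_nat_into {ws :: nat list. ws \<noteq> []} k \<in> {ws. ws \<noteq> []}" by (rule from_nat_into) auto
    then show ?thesis using test_function_word_mult[OF e(1), of "\<lambda>_. 1"] by (simp add: f_def)
  qed
  have [measurable]: "f k \<in> borel_measurable borel" for k
    using test_function_continuous[OF f] by (rule borel_measurable_continuous_onI)
  \<comment> \<open>The explicit cut-off integral over \<open>lborel\<close> makes joint
    measurability in \<open>T\<close> and \<open>\<theta>\<close> visible, which the measure
    \<open>unif 0 T\<close>, itself varying with \<open>T\<close>, would hide. The default 0 covers
    \<open>T \<le> 0\<close>, where \<open>unif 0 T\<close> is not a probability measure.\<close>
  define d where "d k T \<theta> = (if T \<le> 0 then 0 else
    \<bar>(\<integral>t. (if 0 \<le> t \<and> t \<le> T then f k (\<phi> t (p \<theta>)) else 0) \<partial>lborel) / T - (\<integral>y. f k y \<partial>\<mu>)\<bar>)" for k T \<theta>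
  have d_eq: "d k T \<theta> = \<bar>(\<integral>t. f k (\<phi> t (p \<theta>)) \<partial>unif 0 T) - (\<integral>y. f k y \<partial>\<mu>)\<bar>" if "0 < T" for k T \<theta>
  proof -
    have "(\<integral>t. indicator {0..T} t * f k (\<phi> t (p \<theta>)) \<partial>lborel) =
        (\<integral>t. (if 0 \<le> t \<and> t \<le> T then f k (\<phi> t (p \<theta>)) else 0) \<partial>lborel)"
      by (intro Bochner_Integration.integral_cong) (auto simp: indicator_def)
    then show ?thesis using that by (simp add: d_def integral_unif)
  qed
  have d_meas [measurable]: "(\<lambda>(T, \<theta>). d k T \<theta>) \<in> borel_measurable (borel \<Otimes>\<^sub>M borel)" for k
    unfolding d_def by measurable
  have "AE \<theta> in unif a b. \<exists>Z. zero_lower_density Z \<and>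
    (\<forall>k. ((\<lambda>T. d k T \<theta>) \<longlongrightarrow> 0) (inf at_top (principal (- Z))))"
  proof (rule AE_convergence_off_zero_lower_density)
    show "integrable (unif a b) (d k T)" for k T
    proof -
      obtain C where C: "\<And>y. \<bar>f k y\<bar> \<le> C" using test_function_bounded[OF f] by metis
      have "0 \<le> C" using C order_trans[OF abs_ge_zero] by blast
      have "\<bar>d k T \<theta>\<bar> \<le> C + \<bar>\<integral>y. f k y \<partial>\<mu>\<bar>" for \<theta>
      proof (cases "T \<le> 0")
        case False
        then interpret U: prob_space "unif 0 T" by (intro prob_space_unif) simp
        have i: "integrable (unif 0 T) (\<lambda>t. f k (\<phi> t (p \<theta>)))"
          using False C by (intro integrable_orbit[where C = C]) auto
        have "\<bar>\<integral>t. f k (\<phi> t (p \<theta>)) \<partial>unif 0 T\<bar> \<le> (\<integral>t. \<bar>f k (\<phi> t (p \<theta>))\<bar> \<partial>unif 0 T)"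
          by (rule integral_abs_bound)
        also have "\<dots> \<le> C" using i C by (intro U.integral_le_const) auto
        finally show ?thesis using d_eq[of T k \<theta>] False by linarith
      qed (use \<open>0 \<le> C\<close> in \<open>simp add: d_def\<close>)
      then show ?thesis
        by (intro Q.integrable_const_bound[where B = "C + \<bar>\<integral>y. f k y \<partial>\<mu>\<bar>"]) auto
    qed
    show "((\<lambda>T. \<integral>\<theta>. d k T \<theta> \<partial>unif a b) \<longlongrightarrow> 0) at_top" for k
    proof (rule Lim_transform_eventually)
      show "((\<lambda>T. \<integral>\<theta>. \<bar>(\<integral>t. f k (\<phi> t (p \<theta>)) \<partial>unif 0 T) - (\<integral>y. f k y \<partial>\<mu>)\<bar> \<partial>unif a b) \<longlongrightarrow> 0) at_top"
      proof (rule averages_tendsto_in_mean[OF lc Q.prob_space_axioms _ p _ _ _ f])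
        show "\<forall>\<^sub>F T in at_top. prob_space (N T) \<and> sets (N T) = sets borel"
          using N_prob by (intro eventually_mono[OF eventually_gt_at_top[of 0]]) auto
        show "weak_star_limit N \<mu> at_top"
          using lim unfolding N_def .
      qed (use N_integral in auto)
      show "\<forall>\<^sub>F T in at_top. (\<integral>\<theta>. \<bar>(\<integral>t. f k (\<phi> t (p \<theta>)) \<partial>unif 0 T) - (\<integral>y. f k y \<partial>\<mu>)\<bar> \<partial>unif a b)
          = (\<integral>\<theta>. d k T \<theta> \<partial>unif a b)"
        by (intro eventually_mono[OF eventually_gt_at_top[of 0]]) (simp add: d_eq)
    qed
  qed (auto simp: d_def Q.prob_space_axioms)
  then show ?thesis
  proof (rule AE_mp, intro AE_I2 impI)
    fix \<theta>
    assume "\<exists>Z. zero_lower_density Z \<and> (\<forall>k. ((\<lambda>T. d k T \<theta>) \<longlongrightarrow> 0) (inf at_top (principal (- Z))))"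
    then obtain Z where Z: "zero_lower_density Z"
      "\<And>k. ((\<lambda>T. d k T \<theta>) \<longlongrightarrow> 0) (inf at_top (principal (- Z)))" by blast
    let ?F = "inf at_top (principal (- Z))"
    have pos: "\<forall>\<^sub>F T in ?F. 0 < (T :: real)"
      by (rule filter_leD[OF inf_le1 eventually_gt_at_top])
    have "weak_star_limit (\<lambda>T. distr (unif 0 T) borel (\<lambda>t. \<phi> t (p \<theta>))) \<mu> ?F"
    proof (rule weak_star_limitI_words[OF e])
      show "\<forall>\<^sub>F T in ?F. prob_space (distr (unif 0 T) borel (\<lambda>t. \<phi> t (p \<theta>))) \<and>
          sets (distr (unif 0 T) borel (\<lambda>t. \<phi> t (p \<theta>))) = sets borel"
        using pos
      proof eventually_elim
        case (elim T)
        interpret U: prob_space "unif 0 T" using elim by (rule prob_space_unif)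
        show ?case by (auto intro!: U.prob_space_distr)
      qed
      show "((\<lambda>T. \<integral>y. word e ws y \<partial>distr (unif 0 T) borel (\<lambda>t. \<phi> t (p \<theta>))) \<longlongrightarrow> (\<integral>y. word e ws y \<partial>\<mu>)) ?F"
        if ws: "ws \<noteq> []" for ws
      proof -
        obtain k where "from_nat_into {ws. ws \<noteq> []} k = ws"
          using from_nat_into_surj[of "{ws :: nat list. ws \<noteq> []}" ws] ws by auto
        then have k: "word e ws = f k" by (simp add: f_def)
        have "((\<lambda>T. (\<integral>y. f k y \<partial>distr (unif 0 T) borel (\<lambda>t. \<phi> t (p \<theta>))) - (\<integral>y. f k y \<partial>\<mu>)) \<longlongrightarrow> 0) ?F"
        proof (rule tendsto_rabs_zero_cancel, rule Lim_transform_eventually[OF Z(2)[of k]])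
          show "\<forall>\<^sub>F T in ?F. d k T \<theta> =
              \<bar>(\<integral>y. f k y \<partial>distr (unif 0 T) borel (\<lambda>t. \<phi> t (p \<theta>))) - (\<integral>y. f k y \<partial>\<mu>)\<bar>"
            using pos by eventually_elim (simp add: d_eq integral_distr)
        qed
        then show ?thesis unfolding k by (rule LIM_zero_cancel)
      qed
    qed (simp_all add: prob_space_axioms)
    with Z(1) show "\<exists>Z. zero_lower_density Z \<and>
        weak_star_limit (\<lambda>T. distr (unif 0 T) borel (\<lambda>t. \<phi> t (p \<theta>))) \<mu> (inf at_top (principal (- Z)))"
      by blast
  qed
qed

end

section \<open>From the matrix action to a continuous flow and a continuous curve\<close>

lemma geo_in_SL2: "geo t \<in> SL2"
  by (simp add: SL2_def geo_def det_2 flip: exp_add)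

lemma rot_in_SL2: "rot \<theta> \<in> SL2"
  by (simp add: SL2_def rot_def det_2 flip: power2_eq_square)

lemma geo_add: "geo (s + t) = geo s ** geo t"
  by (simp add: geo_def matrix_matrix_mult_def vec_eq_iff forall_2 sum_2 exp_add exp_diff exp_minus field_simps)

lemma continuous_on_geo: "continuous_on S geo"
proof -
  have eq: "geo = (\<lambda>t. \<chi> i. \<chi> j. if i = 1 then if j = 1 then exp t else 0 else if j = 1 then 0 else exp (- t))"
    by (simp add: geo_def fun_eq_iff vec_eq_iff forall_2)
  show ?thesis
  proof (subst eq, intro continuous_on_vec_lambda)
    show "continuous_on S (\<lambda>t. if i = 1 then if j = 1 then exp t else 0 else if j = 1 then 0 else exp (- t))"
      for i j :: 2
      by (cases "i = 1"; cases "j = 1") (auto intro!: continuous_intros)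
  qed
qed

lemma continuous_on_rot: "continuous_on S rot"
proof -
  have eq: "rot = (\<lambda>t. \<chi> i. \<chi> j. if i = j then cos t else if i = 1 then sin t else - sin t)"
    by (simp add: rot_def fun_eq_iff vec_eq_iff forall_2)
  show ?thesis
  proof (subst eq, intro continuous_on_vec_lambda)
    show "continuous_on S (\<lambda>t. if i = j then cos t else if i = 1 then sin t else - sin t)" for i j :: 2
      by (cases "i = j"; cases "i = 1") (auto intro!: continuous_intros)
  qed
qed

lemma continuous_on_SL2_action:
  assumes "continuous_SL2_action act" "continuous_on S A" "\<And>z. z \<in> S \<Longrightarrow> A z \<in> SL2" "continuous_on S g"
  shows "continuous_on S (\<lambda>z. act (A z) (g z))"
proof -
  have "continuous_on (SL2 \<times> UNIV) (\<lambda>(A, y). act A y)"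
    using assms(1) by (simp add: continuous_SL2_action_def)
  then have "continuous_on S ((\<lambda>(A, y). act A y) \<circ> (\<lambda>z. (A z, g z)))"
    using assms(2-4) by (intro continuous_on_compose continuous_on_Pair) (auto elim: continuous_on_subset)
  then show ?thesis by (simp add: comp_def)
qed

theorem corollary1p7:
  fixes act :: "real^2^2 \<Rightarrow> 'a::{second_countable_topology, t2_space} \<Rightarrow> 'a"
    and x :: 'a and a b :: real and \<mu> :: "'a measure"
  assumes "locally_compact_space (euclidean :: 'a topology)"
    and "continuous_SL2_action act"
    and "a < b" and "b \<le> a + 2 * pi"
    and "weak_star_limit
      (\<lambda>T. average (\<lambda>t. average (\<lambda>\<theta>. pushed_dirac act x t \<theta>) a b) 0 T) \<mu> at_top"
    and "flow_ergodic (\<lambda>t. act (geo t)) \<mu>"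
  shows "AE \<theta> in lebesgue. \<theta> \<in> {a..b} \<longrightarrow>
    (\<exists>Z. zero_lower_density Z \<and>
      weak_star_limit (\<lambda>T. average (\<lambda>t. pushed_dirac act x t \<theta>) 0 T) \<mu>
        (inf at_top (principal (- Z))))"
proof -
  note act = assms(2)
  interpret ergodic_flow "\<lambda>t. act (geo t)" \<mu>
  proof
    show "continuous_on UNIV (\<lambda>(t, y). act (geo t) y)"
      unfolding case_prod_unfold
      by (intro continuous_on_SL2_action[OF act] continuous_on_compose2[OF continuous_on_geo[of UNIV]]
          continuous_intros geo_in_SL2) auto
    show "act (geo (s + t)) y = act (geo s) (act (geo t) y)" for s t y
      using act geo_in_SL2 by (simp add: continuous_SL2_action_def geo_add)
  qed fact
  define p where "p \<theta> = act (rot \<theta>) x" for \<theta>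
  have p [measurable]: "p \<in> borel \<rightarrow>\<^sub>M borel"
    unfolding p_def
    by (intro borel_measurable_continuous_onI continuous_on_SL2_action[OF act] continuous_on_rot
        rot_in_SL2 continuous_intros)
  \<comment> \<open>The image of a point mass is a point mass, and binding point masses gives an
    image measure; this turns single averages into \<open>distr\<close>.\<close>
  have dirac: "pushed_dirac act x t \<theta> = return borel (act (geo t) (p \<theta>))" for t \<theta>
  proof -
    have "act (geo t) \<circ> act (rot \<theta>) \<in> borel \<rightarrow>\<^sub>M borel"
      unfolding comp_def
      by (intro borel_measurable_continuous_onI continuous_on_SL2_action[OF act] rot_in_SL2 geo_in_SL2
          continuous_intros)
    then show ?thesis by (simp add: pushed_dirac_def distr_return p_def)
  qed
  have avg_t: "average (\<lambda>t. pushed_dirac act x t \<theta>) c d = distr (unif c d) borel (\<lambda>t. act (geo t) (p \<theta>))" for c d \<theta>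
    unfolding average_def dirac by (intro bind_return_distr') auto
  have avg_\<theta>: "average (\<lambda>\<theta>. pushed_dirac act x t \<theta>) c d = distr (unif c d) borel (\<lambda>\<theta>. act (geo t) (p \<theta>))" for c d t
    unfolding average_def dirac by (intro bind_return_distr') auto
  have "AE \<theta> in unif a b. \<exists>Z. zero_lower_density Z \<and>
    weak_star_limit (\<lambda>T. average (\<lambda>t. pushed_dirac act x t \<theta>) 0 T) \<mu> (inf at_top (principal (- Z)))"
    \<comment> \<open>In the hypothesis only the inner average over angles becomes a
      \<open>distr\<close>; the outer one over times stays a \<open>bind\<close>, as
      \<open>AE_orbit_averages_converge\<close> expects.\<close>
    using assms(5) unfolding avg_\<theta> avg_t unfolding average_def
    by (intro AE_orbit_averages_converge assms(1,3) p)
  then have "AE \<theta> in lborel. \<theta> \<in> {a..b} \<longrightarrow> (\<exists>Z. zero_lower_density Z \<and>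
    weak_star_limit (\<lambda>T. average (\<lambda>t. pushed_dirac act x t \<theta>) 0 T) \<mu> (inf at_top (principal (- Z))))"
    using \<open>a < b\<close> by (subst (asm) AE_uniform_measure) auto
  then show ?thesis by (rule AE_completion)
qed

end
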